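(* The classes $\#\mathrm{P}_{\{-1,1\}}$ and $\#\mathrm{P}_{\{-1,0,1\}}$ (the latter being equal to $\#\mathrm{P}_{\mathbb{Z}}$) are $\#\mathrm{P}$-equivalent.
   Context: Weighted counting problem: it is given by a polynomial $p:\mathbb{N}\to\mathbb{N}$ and a function $w:\{0,1\}^\star\times\{0,1\}^\star\to\mathbb{R}$ for which there is a function $v:\{0,1\}^\star\times\{0,1\}^\star\times\mathbb{N}\to\mathbb{Z}$ such that $v(x,u,b)$ is computable in time polynomial in $|x|$, $|u|$ and $b$, and $|w(x,u)-v(x,u,b)/2^b|\le 2^{-b}$ for all $x,u\in\{0,1\}^\star$, $b\in\mathbb{N}$. The problem is to compute, for $x\in\{0,1\}^\star$, the function $f(x)=\sum_{u\in\{0,1\}^{p(|x|)}} w(x,u)$. For $S\subseteq\mathbb{R}$, $\#\mathrm{P}_S$ is the class of all weighted counting problems (identified with the functions $f$ they define) where the range of $w$ is contained in $S$. $\#\mathrm{P}$ is the usual class of counting functions $f(x)=\sum_{u\in\{0,1\}^{p(|x|)}}T(x,u)$ with $p$ a polynomial and $T$ a polynomial-time $\{0,1\}$-valued predicate. A function $f:\{0,1\}^\star\to\mathbb{R}$ affinely reduces to $g:\{0,1\}^\star\to\mathbb{R}$ if there are polynomial-time computable functions $h_1,h_2,h_3$ ($h_1,h_3$ rational-valued, $h_2$ string-valued) with $f(x)=h_1(x)\cdot g(h_2(x))+h_3(x)$ for all $x\in\{0,1\}^\star$. A class $C$ of functions is $\#\mathrm{P}$-equivalent if every problem in $C$ affinely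 reduces to some problem in $\#\mathrm{P}$ and every problem in $\#\mathrm{P}$ affinely reduces to some problem in $C$. *)

theory Defs
  imports Complex_Main "HOL-Computational_Algebra.Polynomial"
begin

text \<open>The coefficients need not be natural numbers, as in \<open>n * (n - 1) / 2\<close>.\<close>

definition polynomial_fun :: "(nat \<Rightarrow> nat) \<Rightarrow> bool" where
  "polynomial_fun p \<longleftrightarrow> (\<exists>q :: real poly. \<forall>n. real (p n) = poly q (real n))"

text \<open>Turing machines are deterministic with several tapes. The tape alphabet is
  \<open>{0, 1, blank}\<close>, with \<^const>\<open>None\<close> as the blank. Tapes are infinite in both directions and
  indexed relative to the head, which therefore always scans cell 0; a head movement shifts the
  tape contents.\<close>

type_synonym symbol = "bool option"
type_synonym tape = "int \<Rightarrow> symbol"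

datatype head_move = Move_Left | Stay | Move_Right

text \<open>The states are \<open>{0..state_count}\<close>; 0 is the initial state and \<open>state_count\<close> the only halting
  state. In each step, \<open>trans\<close> maps the current state and the list of scanned symbols to the next
  state and, for each tape, the symbol to be written and the subsequent head movement.\<close>

record turing_machine =
  tape_count :: nat
  state_count :: nat
  trans :: "nat \<Rightarrow> symbol list \<Rightarrow> nat \<times> (symbol \<times> head_move) list"

definition wf_machine :: "turing_machine \<Rightarrow> bool" where
  "wf_machine M \<longleftrightarrow>
     (\<forall>q < state_count M. \<forall>s. length s = tape_count M \<longrightarrow>
        fst (trans M q s) \<le> state_count M \<and> length (snd (trans M q s)) = tape_count M)"

fun head_offset :: "head_move \<Rightarrow> int" where
  "head_offset Move_Left = -1"
| "head_offset Stay = 0"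
| "head_offset Move_Right = 1"

fun update_tape :: "symbol \<times> head_move \<Rightarrow> tape \<Rightarrow> tape" where
  "update_tape (a, d) t = (\<lambda>i. (t(0 := a)) (i + head_offset d))"

type_synonym config = "nat \<times> tape list"

fun step :: "turing_machine \<Rightarrow> config \<Rightarrow> config" where
  "step M (q, ts) =
     (if q < state_count M
      then let (q', acts) = trans M q (map (\<lambda>t. t 0) ts) in (q', map2 update_tape acts ts)
      else (q, ts))"

definition string_tape :: "bool list \<Rightarrow> tape" where
  "string_tape s = (\<lambda>i. if 0 \<le> i \<and> i < int (length s) then Some (s ! nat i) else None)"

text \<open>Each argument is written on a tape of its own; the remaining tapes are blank.\<close>

definition initial_config :: "turing_machine \<Rightarrow> bool list list \<Rightarrow> config" where
  "initial_config M xs =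
     (0, map string_tape xs @ replicate (tape_count M - length xs) (string_tape []))"

text \<open>A string is read off a tape from the head up to, but excluding, the first blank.\<close>

definition reads_from_head :: "tape \<Rightarrow> bool list \<Rightarrow> bool" where
  "reads_from_head t y \<longleftrightarrow>
     (\<forall>i < length y. t (int i) = Some (y ! i)) \<and> t (int (length y)) = None"

text \<open>Since halting configurations are fixed by \<^const>\<open>step\<close>, the following says that the machine
  halts after at most \<open>n\<close> steps, with output \<open>y\<close> on its first tape.\<close>

definition outputs_within :: "turing_machine \<Rightarrow> bool list list \<Rightarrow> nat \<Rightarrow> bool list \<Rightarrow> bool" where
  "outputs_within M xs n y \<longleftrightarrow>
     (let (q, ts) = (step M ^^ n) (initial_config M xs)
      in q = state_count M \<and> reads_from_head (hd ts) y)"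

text \<open>Being bounded by a polynomial in the total length of the arguments is the same as being bounded
  by a polynomial in their individual lengths.\<close>

definition polytime :: "nat \<Rightarrow> (bool list list \<Rightarrow> bool list) \<Rightarrow> bool" where
  "polytime k F \<longleftrightarrow>
     (\<exists>M t. wf_machine M \<and> 1 \<le> tape_count M \<and> k \<le> tape_count M \<and> polynomial_fun t \<and>
        (\<forall>xs. length xs = k \<longrightarrow> outputs_within M xs (t (sum_list (map length xs))) (F xs)))"

text \<open>Integers are written in binary: a sign bit, followed by the binary digits of the absolute
  value, least significant digit first and without leading zeros.\<close>

fun nat_bits :: "nat \<Rightarrow> bool list" where
  "nat_bits n = (if n = 0 then [] else odd n # nat_bits (n div 2))"

declare nat_bits.simps [simp del]

definition int_bits :: "int \<Rightarrow> bool list" where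
  "int_bits z = (z < 0) # nat_bits (nat \<bar>z\<bar>)"

definition polytime_string_fun :: "(bool list \<Rightarrow> bool list) \<Rightarrow> bool" where
  "polytime_string_fun h \<longleftrightarrow> polytime 1 (\<lambda>xs. h (xs ! 0))"

definition polytime_int_fun :: "(bool list \<Rightarrow> int) \<Rightarrow> bool" where
  "polytime_int_fun h \<longleftrightarrow> polytime_string_fun (\<lambda>x. int_bits (h x))"

text \<open>A rational number is output as a numerator and a denominator, not necessarily coprime.\<close>

definition polytime_rat_fun :: "(bool list \<Rightarrow> rat) \<Rightarrow> bool" where
  "polytime_rat_fun h \<longleftrightarrow>
     (\<exists>num den. polytime_int_fun num \<and> polytime_int_fun den \<and>
        (\<forall>x. den x > 0 \<and> h x = of_int (num x) / of_int (den x)))"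

definition polytime_predicate :: "(bool list \<Rightarrow> bool list \<Rightarrow> bool) \<Rightarrow> bool" where
  "polytime_predicate T \<longleftrightarrow> polytime 2 (\<lambda>xs. [T (xs ! 0) (xs ! 1)])"

text \<open>The argument \<open>b\<close> is given in unary, so the running time is polynomial in \<open>|x|\<close>, \<open>|u|\<close> and the
  value of \<open>b\<close>. The third tape ranges over arbitrary strings in \<^const>\<open>polytime\<close>; only its length is
  taken into account.\<close>

definition polytime_approx :: "(bool list \<Rightarrow> bool list \<Rightarrow> nat \<Rightarrow> int) \<Rightarrow> bool" where
  "polytime_approx v \<longleftrightarrow> polytime 3 (\<lambda>xs. int_bits (v (xs ! 0) (xs ! 1) (length (xs ! 2))))"

definition weighted_counting_problem ::
    "(nat \<Rightarrow> nat) \<Rightarrow> (bool list \<Rightarrow> bool list \<Rightarrow> real) \<Rightarrow> bool" where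
  "weighted_counting_problem p w \<longleftrightarrow>
     polynomial_fun p \<and>
     (\<exists>v. polytime_approx v \<and>
        (\<forall>x u b. \<bar>w x u - real_of_int (v x u b) / 2 ^ b\<bar> \<le> 1 / 2 ^ b))"

definition counting_function ::
    "(nat \<Rightarrow> nat) \<Rightarrow> (bool list \<Rightarrow> bool list \<Rightarrow> real) \<Rightarrow> bool list \<Rightarrow> real" where
  "counting_function p w x = (\<Sum>u | length u = p (length x). w x u)"

definition sharpP_weighted :: "real set \<Rightarrow> (bool list \<Rightarrow> real) set" where
  "sharpP_weighted S =
     {counting_function p w | p w. weighted_counting_problem p w \<and> (\<forall>x u. w x u \<in> S)}"

definition sharpP :: "(bool list \<Rightarrow> real) set" where
  "sharpP =
     {counting_function p (\<lambda>x u. of_bool (T x u)) | p T. polynomial_fun p \<and> polytime_predicate T}"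

definition affinely_reduces :: "(bool list \<Rightarrow> real) \<Rightarrow> (bool list \<Rightarrow> real) \<Rightarrow> bool" where
  "affinely_reduces f g \<longleftrightarrow>
     (\<exists>h1 h2 h3. polytime_rat_fun h1 \<and> polytime_string_fun h2 \<and> polytime_rat_fun h3 \<and>
        (\<forall>x. f x = of_rat (h1 x) * g (h2 x) + of_rat (h3 x)))"

definition sharpP_equivalent :: "(bool list \<Rightarrow> real) set \<Rightarrow> bool" where
  "sharpP_equivalent C \<longleftrightarrow>
     (\<forall>f\<in>C. \<exists>g\<in>sharpP. affinely_reduces f g) \<and> (\<forall>f\<in>sharpP. \<exists>g\<in>C. affinely_reduces f g)"

end

theory Submission
  imports Defs
begin

text \<open>Since \<open>{-1, 1} \<subseteq> {-1, 0, 1} \<subseteq> \<int>\<close>, three constructions suffice.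
  (1) For \<open>w\<close> with values in \<open>{-1, 0, 1}\<close>, an extra bit turns \<open>1 - w\<close> into the number of
  witnesses of a predicate, so that \<open>2 ^ p - f\<close> is in \<open>#P\<close>.
  (2) For a predicate \<open>T\<close>, the weights \<open>1 - 2 T\<close> sum to \<open>2 ^ p - 2 f\<close>.
  (3) For an integer \<open>w\<close>, append a string \<open>y\<close>, at least as long as any output \<open>v x u 2\<close>, and give \<open>(y, u)\<close>
  the weight \<open>sgn w\<close> if \<open>y < |w|\<close>, as a binary number, and \<open>0\<close> otherwise.
  An integer-valued polynomial \<open>p\<close> is a difference of two combinations of binomial coefficients with
  natural coefficients. These are computed in unary by difference schemes, so \<open>2 ^ p\<close> is a quotient of
  two computable powers of 2. The machines treat tapes as stacks; the closure of polynomial time under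
  composition reduces everything to a few primitive functions.\<close>

subsection \<open>Integer-valued polynomials\<close>

text \<open>Two features of the definitions shape the proof. A polynomial may have negative or
  fractional coefficients, so it is neither monotone in general nor computable by additions of unary
  strings along its coefficients; a Newton form with natural coefficients is both, and such forms
  majorise every polynomial. They serve as time bounds, as length of the additional string and as
  exponents of 2. The weights are known through approximations only. At precision 2 an integer
  \<open>k\<close> appears as some \<open>c\<close> with \<open>|4 * k - c| \<le> 1\<close>, so the
  threshold \<open>4 * m + 2\<close> falls into a gap: \<open>|c|\<close> exceeds it if
  \<open>m < |k|\<close> and stays below it otherwise. One comparison machine thus decides
  \<open>m < |k|\<close> without error, in construction (3) and, with \<open>m = 0\<close>, in (1).
  Composition has an obstacle of its own: a machine promises nothing about its tapes except the
  output up to the first blank. So every subroutine runs on a fresh block of tapes, and only its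
  output is carried over.\<close>

lemma polynomial_fun_const [intro]: "polynomial_fun (\<lambda>_. c)"
  unfolding polynomial_fun_def by (intro exI[of _ "[:real c:]"]) simp

lemma polynomial_fun_id [intro]: "polynomial_fun (\<lambda>n. n)"
  unfolding polynomial_fun_def by (intro exI[of _ "[:0, 1:]"]) simp

lemma polynomial_fun_add [intro]:
  assumes "polynomial_fun p" "polynomial_fun q"
  shows "polynomial_fun (\<lambda>n. p n + q n)"
proof -
  obtain a b where "\<forall>n. real (p n) = poly a (real n)" "\<forall>n. real (q n) = poly b (real n)"
    using assms unfolding polynomial_fun_def by blast
  then show ?thesis unfolding polynomial_fun_def by (intro exI[of _ "a + b"]) simp
qed

lemma polynomial_fun_mult [intro]:
  assumes "polynomial_fun p" "polynomial_fun q"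
  shows "polynomial_fun (\<lambda>n. p n * q n)"
proof -
  obtain a b where "\<forall>n. real (p n) = poly a (real n)" "\<forall>n. real (q n) = poly b (real n)"
    using assms unfolding polynomial_fun_def by blast
  then show ?thesis unfolding polynomial_fun_def by (intro exI[of _ "a * b"]) simp
qed

lemma polynomial_fun_compose:
  assumes "polynomial_fun p" "polynomial_fun q"
  shows "polynomial_fun (\<lambda>n. p (q n))"
proof -
  obtain a b where "\<forall>n. real (p n) = poly a (real n)" "\<forall>n. real (q n) = poly b (real n)"
    using assms unfolding polynomial_fun_def by blast
  then show ?thesis unfolding polynomial_fun_def by (intro exI[of _ "pcompose a b"]) (simp add: poly_pcompose)
qed

lemma polynomial_fun_choose: "polynomial_fun (\<lambda>n. n choose k)"
proof -
  define q :: "real poly" where "q = smult (inverse (fact k)) (\<Prod>i=0..<k. [:- real i, 1:])"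
  have "real (n choose k) = poly q (real n)" for n
    by (simp add: binomial_gbinomial gbinomial_prod_rev q_def poly_prod divide_inverse mult.commute)
  then show ?thesis unfolding polynomial_fun_def by blast
qed

text \<open>Newton's forward-difference form: \<open>c\<close> is the value at 0 and
  \<open>cs\<close> describes the differences. It makes the step from \<open>n\<close> to
  \<open>n + 1\<close> a single addition per entry.\<close>

fun newton :: "nat list \<Rightarrow> nat \<Rightarrow> nat" where
  "newton [] n = 0"
| "newton (c # cs) n = c + (\<Sum>k<n. newton cs k)"

lemma newton_Suc: "newton cs (Suc n) = newton cs n + newton (tl cs) n"
  by (cases cs) simp_all

lemma mono_newton: "mono (newton cs)"
  by (intro mono_iff_le_Suc[THEN iffD2] allI) (simp add: newton_Suc)

text \<open>Turns the factor 1/2 in \<open>2 ^ p / 2\<close> into one more power of 2 in the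
  denominator.\<close>

lemma newton_Suc_const: "\<exists>cs'. \<forall>n. newton cs' n = Suc (newton cs n)"
proof (cases cs)
  case Nil
  then show ?thesis by (intro exI[of _ "[1]"]) simp
next
  case (Cons c ds)
  then show ?thesis by (intro exI[of _ "Suc c # ds"]) simp
qed

lemma newton_eq_choose: "newton cs n = (\<Sum>i<length cs. cs ! i * (n choose i))"
proof (induction cs arbitrary: n)
  case (Cons c cs)
  \<comment> \<open>The hockey-stick identity: summation raises the lower index by one, which
    matches the shift of the coefficients by \<open>c #\<close>.\<close>
  have "(\<Sum>k<n. k choose i) = n choose Suc i" for i
    using sum_choose_upper[of i "n - 1"] by (cases n) (simp_all add: lessThan_Suc_atMost)
  then have "(\<Sum>k<n. newton cs k) = (\<Sum>i<length cs. cs ! i * (n choose Suc i))"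
    by (simp add: Cons.IH sum.swap[of _ "{..<length cs}"] flip: sum_distrib_left)
  then show ?case by (simp add: sum.lessThan_Suc_shift del: sum.lessThan_Suc)
qed simp

lemma polynomial_fun_newton [intro]: "polynomial_fun (newton cs)"
proof -
  have "polynomial_fun (\<lambda>n. \<Sum>i<m. cs ! i * (n choose i))" for m
  proof (induction m)
    case (Suc m)
    then show ?case
      unfolding sum.lessThan_Suc
      by (intro polynomial_fun_add polynomial_fun_mult polynomial_fun_const polynomial_fun_choose)
  qed (simp add: polynomial_fun_const)
  then show ?thesis by (simp add: newton_eq_choose[abs_def])
qed

text \<open>Shifting the argument changes neither degree nor leading coefficient, so the top terms
  cancel.\<close>

lemma degree_forward_difference:
  fixes q :: "real poly"
  assumes "degree q > 0"
  shows "degree (pcompose q [:1, 1:] - q) < degree q"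
proof -
  have d: "degree (pcompose q [:1, 1:]) = degree q" by (simp add: degree_pcompose)
  have "lead_coeff (pcompose q [:1, 1:]) = lead_coeff q" by (simp add: lead_coeff_comp)
  then have "coeff (pcompose q [:1, 1:] - q) (degree q) = 0" by (simp add: d)
  moreover have "degree (pcompose q [:1, 1:] - q) \<le> degree q" by (intro degree_diff_le) (simp_all add: d)
  ultimately show ?thesis using assms
    by (metis degree_0 le_neq_implies_less leading_coeff_0_iff)
qed

text \<open>Stated for integer values, since differences of a natural-valued polynomial may be
  negative. The forward difference has smaller degree; the positive and the negative part of
  \<open>f 0\<close> become the heads of the two lists.\<close>

lemma integer_valued_polynomial_newton:
  fixes f :: "nat \<Rightarrow> int" and q :: "real poly"
  assumes "\<And>n. real_of_int (f n) = poly q (real n)"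
  shows "\<exists>cs ds. \<forall>n. f n = int (newton cs n) - int (newton ds n)"
  using assms
proof (induction "degree q" arbitrary: f q rule: less_induct)
  case less
  show ?case
  proof (cases "degree q = 0")
    case True
    then obtain a where "q = [:a:]" by (metis degree_eq_zeroE)
    then have "real_of_int (f n) = real_of_int (f 0)" for n using less.prems by simp
    then have "f n = f 0" for n by (metis of_int_eq_iff)
    then have "f n = int (newton [nat (f 0)] n) - int (newton [nat (- f 0)] n)" for n
      by (cases "f 0 \<ge> 0") simp_all
    then show ?thesis by blast
  next
    case False
    have "\<exists>cs ds. \<forall>n. f (Suc n) - f n = int (newton cs n) - int (newton ds n)"
      using less.prems False
      by (intro less.hyps[of "pcompose q [:1, 1:] - q"])
        (simp_all add: degree_forward_difference poly_pcompose add.commute)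
    then obtain cs ds where st: "f (Suc n) - f n = int (newton cs n) - int (newton ds n)" for n by blast
    have "f n = int (newton (nat (f 0) # cs) n) - int (newton (nat (- f 0) # ds) n)" for n
    proof (induction n)
      case (Suc n)
      then show ?case using st[of n] by simp
    qed simp
    then show ?thesis by blast
  qed
qed

lemma polynomial_fun_newton_diff:
  assumes "polynomial_fun p"
  obtains cs ds where "\<And>n. p n + newton ds n = newton cs n"
proof -
  obtain q where "\<forall>n. real (p n) = poly q (real n)" using assms unfolding polynomial_fun_def by blast
  then obtain cs ds where "int (p n) = int (newton cs n) - int (newton ds n)" for n
    using integer_valued_polynomial_newton[of "\<lambda>n. int (p n)" q] by auto
  then show ?thesis using that[of ds cs]
    by (metis (no_types, lifting) add.commute diff_add_cancel of_nat_add of_nat_eq_iff)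
qed

text \<open>Dropping the subtracted part leaves a majorant that is monotone and can be evaluated by
  a machine.\<close>

lemma polynomial_fun_le_newton:
  assumes "polynomial_fun p"
  obtains cs where "\<And>n. p n \<le> newton cs n"
  using polynomial_fun_newton_diff[OF assms] by (metis le_add1)

subsection \<open>Combining Turing machines\<close>

definition is_tm :: "nat \<Rightarrow> turing_machine \<Rightarrow> bool" where
  "is_tm K M \<longleftrightarrow> wf_machine M \<and> tape_count M = K"

text \<open>The initial tapes are arbitrary, not an encoded input, so that runs can be chained; the
  time is an upper bound, so that it can be weakened.\<close>

definition runs :: "turing_machine \<Rightarrow> nat \<Rightarrow> tape list \<Rightarrow> tape list \<Rightarrow> bool" where
  "runs M n ts ts' \<longleftrightarrow> (\<exists>j\<le>n. (step M ^^ j) (0, ts) = (state_count M, ts'))"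

abbreviation tapes :: "nat \<Rightarrow> (nat \<Rightarrow> tape) \<Rightarrow> tape list" where
  "tapes K \<tau> \<equiv> map \<tau> [0..<K]"

lemma runs_mono: "runs M n ts ts' \<Longrightarrow> n \<le> m \<Longrightarrow> runs M m ts ts'"
  unfolding runs_def using le_trans by blast

lemma steps_halted: "(step M ^^ n) (state_count M, ts) = (state_count M, ts)"
  by (induction n) simp_all

lemma is_tmD:
  assumes "is_tm K M" "q < state_count M" "length s = K"
  shows "fst (trans M q s) \<le> state_count M" "length (snd (trans M q s)) = K"
  using assms unfolding is_tm_def wf_machine_def by auto

lemma step_wf:
  assumes "is_tm K M" "length ts = K" "q \<le> state_count M" "step M (q, ts) = (q', ts')"
  shows "q' \<le> state_count M" "length ts' = K"
  using assms is_tmD[OF assms(1), of q "map (\<lambda>t. t 0) ts"]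
  by (auto split: if_splits prod.splits)

text \<open>Common core of composition, loop and embedding: \<open>e\<close> and \<open>h\<close>
  translate states and tapes of \<open>M\<close> into those of \<open>S\<close>. Only steps from
  non-halting states have to agree, so \<open>e\<close> may send the halting state to one from which
  \<open>S\<close> goes on.\<close>

lemma simulate:
  assumes M: "is_tm K M"
    and sim: "\<And>q ts q' ts'. q < state_count M \<Longrightarrow> length ts = K \<Longrightarrow> step M (q, ts) = (q', ts') \<Longrightarrow>
      step S (e q, h ts) = (e q', h ts')"
    and "length ts = K" "q \<le> state_count M" "(step M ^^ j) (q, ts) = (q', ts')"
  shows "\<exists>i\<le>j. (step S ^^ i) (e q, h ts) = (e q', h ts')"
  using assms(3-5)
proof (induction j arbitrary: q ts)
  case 0
  then show ?case by simp
next
  case (Suc j)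
  show ?case
  proof (cases "q < state_count M")
    case True
    obtain q1 ts1 where st: "step M (q, ts) = (q1, ts1)" by fastforce
    then have "(step M ^^ j) (q1, ts1) = (q', ts')"
      using Suc.prems(3) by (simp del: step.simps funpow.simps add: funpow_Suc_right)
    then obtain i where "i \<le> j" "(step S ^^ i) (e q1, h ts1) = (e q', h ts')"
      using Suc.IH step_wf[OF M Suc.prems(1,2) st] by blast
    then show ?thesis using sim[OF True Suc.prems(1) st]
      by (intro exI[of _ "Suc i"]) (simp del: step.simps funpow.simps add: funpow_Suc_right)
  next
    case False
    \<comment> \<open>\<open>M\<close> idles in its halting state but \<open>S\<close> need not, so
      \<open>S\<close> takes no step here; hence the claim is only \<open>i \<le> j\<close>.\<close>
    then have "q = state_count M" using Suc.prems by simp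
    then have "(q', ts') = (q, ts)" using Suc.prems(3) steps_halted[of "Suc j" M ts] by simp
    then show ?thesis by (intro exI[of _ 0]) simp
  qed
qed

lemma simulate_runs:
  assumes "is_tm K M" "length ts = K" "runs M n ts ts'"
    and "\<And>q ts q' ts'. q < state_count M \<Longrightarrow> length ts = K \<Longrightarrow> step M (q, ts) = (q', ts') \<Longrightarrow>
      step S (e q, h ts) = (e q', h ts')"
  shows "\<exists>i\<le>n. (step S ^^ i) (e 0, h ts) = (e (state_count M), h ts')"
proof -
  obtain j where j: "j \<le> n" "(step M ^^ j) (0, ts) = (state_count M, ts')"
    using assms(3) unfolding runs_def by blast
  have "\<exists>i\<le>j. (step S ^^ i) (e 0, h ts) = (e (state_count M), h ts')"
    by (rule simulate[OF assms(1) _ assms(2) _ j(2)]) (use assms(4) in simp_all)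
  then show ?thesis using j(1) le_trans by blast
qed

lemma runs_length:
  assumes "is_tm K M" "length ts = K" "runs M n ts ts'"
  shows "length ts' = K"
proof -
  have "length (snd ((step M ^^ j) (0, ts))) = K \<and> fst ((step M ^^ j) (0, ts)) \<le> state_count M" for j
  proof (induction j)
    case (Suc j)
    then show ?case using step_wf[OF assms(1), of "snd ((step M ^^ j) (0, ts))" "fst ((step M ^^ j) (0, ts))"]
      by (metis comp_apply funpow.simps(2) prod.collapse)
  qed (use assms in simp)
  then show ?thesis using assms(3) unfolding runs_def by (metis snd_conv)
qed

section \<open>Sequential composition, loops and embedding into more tapes\<close>

definition seq :: "turing_machine \<Rightarrow> turing_machine \<Rightarrow> turing_machine" where
  "seq M N = \<lparr>tape_count = tape_count M, state_count = state_count M + state_count N,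
     trans = (\<lambda>q s. if q < state_count M then trans M q s
        else apfst ((+) (state_count M)) (trans N (q - state_count M) s))\<rparr>"

lemma seq_tm [intro!]:
  assumes "is_tm K M" "is_tm K N"
  shows "is_tm K (seq M N)"
  unfolding is_tm_def wf_machine_def
proof (intro conjI allI impI)
  show "tape_count (seq M N) = K" using assms by (simp add: seq_def is_tm_def)
next
  fix q and s :: "symbol list"
  assume q: "q < state_count (seq M N)" and s: "length s = tape_count (seq M N)"
  then have s: "length s = K" using assms by (simp add: seq_def is_tm_def)
  have "fst (trans (seq M N) q s) \<le> state_count (seq M N) \<and> length (snd (trans (seq M N) q s)) = K"
  proof (cases "q < state_count M")
    case True
    then show ?thesis using is_tmD[OF assms(1) True s] by (simp add: seq_def)
  next
    case False
    then show ?thesis using q is_tmD[OF assms(2) _ s, of "q - state_count M"] by (simp add: seq_def)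
  qed
  then show "fst (trans (seq M N) q s) \<le> state_count (seq M N)"
    "length (snd (trans (seq M N) q s)) = tape_count (seq M N)"
    using assms by (simp_all add: seq_def is_tm_def)
qed

text \<open>The halting state of \<open>M\<close> has the same number as the shifted initial state
  of \<open>N\<close>, so the hand-over takes no step.\<close>

lemma runs_seq:
  assumes M: "is_tm K M" and N: "is_tm K N" and "length ts = K" "runs M m ts ts1" "runs N n ts1 ts2"
  shows "runs (seq M N) (m + n) ts ts2"
proof -
  have "\<exists>i\<le>m. (step (seq M N) ^^ i) (id 0, id ts) = (id (state_count M), id ts1)"
    by (rule simulate_runs[OF M assms(3,4)]) (simp add: seq_def)
  then obtain i where i: "i \<le> m" "(step (seq M N) ^^ i) (0, ts) = (state_count M, ts1)" by auto
  have "\<exists>i\<le>n. (step (seq M N) ^^ i) (state_count M + 0, id ts1) = (state_count M + state_count N, id ts2)"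
    by (rule simulate_runs[OF N runs_length[OF M assms(3,4)] assms(5)])
      (auto simp: seq_def split: prod.splits)
  then obtain j where j: "j \<le> n"
    "(step (seq M N) ^^ j) (state_count M, ts1) = (state_count M + state_count N, ts2)" by auto
  have "(step (seq M N) ^^ (j + i)) (0, ts) = (state_count (seq M N), ts2)"
    using i j by (simp add: funpow_add seq_def)
  then show ?thesis using i j unfolding runs_def by (intro exI[of _ "j + i"]) simp
qed

definition keep :: "symbol list \<Rightarrow> (symbol \<times> head_move) list" where
  "keep s = map (\<lambda>a. (a, Stay)) s"

lemma length_keep [simp]: "length (keep s) = length s"
  by (simp add: keep_def)

lemma update_tape_stay [simp]: "update_tape (t 0, Stay) t = t"
  by auto

lemma update_keep: "map2 update_tape (keep (map (\<lambda>t. t 0) ts)) ts = ts"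
  by (induction ts) (auto simp: keep_def)

text \<open>State 0 is the test; the states of \<open>M\<close> are shifted by one, and its halting
  state is identified with 0.\<close>

definition loop :: "(symbol list \<Rightarrow> bool) \<Rightarrow> turing_machine \<Rightarrow> turing_machine" where
  "loop c M = (let e = (\<lambda>q. if q = state_count M then 0 else Suc q) in
     \<lparr>tape_count = tape_count M, state_count = Suc (state_count M),
      trans = (\<lambda>q s. if q = 0 then (if c s then e 0 else Suc (state_count M), keep s)
        else apfst e (trans M (q - 1) s))\<rparr>)"

lemma loop_tm [intro!]:
  assumes "is_tm K M"
  shows "is_tm K (loop c M)"
proof -
  have K: "tape_count (loop c M) = K" using assms by (simp add: loop_def is_tm_def)
  have "fst (trans (loop c M) q s) \<le> state_count (loop c M) \<and> length (snd (trans (loop c M) q s)) = K"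
    if "q < state_count (loop c M)" "length s = K" for q s
    using that is_tmD[OF assms _ that(2), of "q - 1"]
    by (cases "q = 0") (auto simp: loop_def Let_def)
  then show ?thesis using K unfolding is_tm_def wf_machine_def by simp
qed

lemma runs_loop_done:
  assumes "\<not> c (map (\<lambda>t. t 0) ts)"
  shows "runs (loop c M) 1 ts ts"
  unfolding runs_def using assms
  by (intro exI[of _ 1]) (simp add: loop_def Let_def update_keep)

lemma runs_loop_step:
  assumes M: "is_tm K M" and "length ts = K" "c (map (\<lambda>t. t 0) ts)"
    and "runs M m ts ts1" "runs (loop c M) n ts1 ts2"
  shows "runs (loop c M) (Suc (m + n)) ts ts2"
proof -
  define e where "e q = (if q = state_count M then 0 else Suc q)" for q
  have "\<exists>i\<le>m. (step (loop c M) ^^ i) (e 0, id ts) = (e (state_count M), id ts1)"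
    by (rule simulate_runs[OF M assms(2,4)])
      (auto simp: loop_def Let_def e_def split: prod.splits)
  then obtain i where i: "i \<le> m" "(step (loop c M) ^^ i) (e 0, ts) = (0, ts1)"
    by (auto simp: e_def)
  obtain j where j: "j \<le> n" "(step (loop c M) ^^ j) (0, ts1) = (state_count (loop c M), ts2)"
    using assms(5) unfolding runs_def by blast
  have "step (loop c M) (0, ts) = (e 0, ts)"
    using assms(3) by (simp add: loop_def Let_def e_def update_keep)
  then have "(step (loop c M) ^^ (j + (i + 1))) (0, ts) = (state_count (loop c M), ts2)"
    using i j by (simp del: step.simps add: funpow_add funpow_swap1)
  then show ?thesis using i j unfolding runs_def by (intro exI[of _ "j + (i + 1)"]) simp
qed

definition basic :: "nat \<Rightarrow> (symbol list \<Rightarrow> nat \<Rightarrow> symbol \<times> head_move) \<Rightarrow> turing_machine" where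
  "basic K f = \<lparr>tape_count = K, state_count = 1, trans = (\<lambda>q s. (1, map (f s) [0..<K]))\<rparr>"

lemma basic_tm [intro!]: "is_tm K (basic K f)"
  by (auto simp: is_tm_def wf_machine_def basic_def)

lemma map2_tapes: "map2 g (map f [0..<K]) (tapes K \<tau>) = map (\<lambda>k. g (f k) (\<tau> k)) [0..<K]"
  by (auto intro: nth_equalityI)

lemma runs_basic:
  assumes "\<And>k. k < K \<Longrightarrow> \<tau>' k = update_tape (f (map (\<lambda>k. \<tau> k 0) [0..<K]) k) (\<tau> k)"
  shows "runs (basic K f) 1 (tapes K \<tau>) (tapes K \<tau>')"
  unfolding runs_def using assms
  by (intro exI[of _ 1]) (auto simp: basic_def map2_tapes comp_def)

text \<open>Gives a subroutine a block of tapes of its own, so that whatever it leaves there cannot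
  disturb other data.\<close>

definition embed :: "nat \<Rightarrow> nat \<Rightarrow> turing_machine \<Rightarrow> turing_machine" where
  "embed K a M = \<lparr>tape_count = K, state_count = state_count M,
     trans = (\<lambda>q s. let (q', acts) = trans M q (map (\<lambda>k. s ! (a + k)) [0..<tape_count M])
       in (q', map (\<lambda>k. if a \<le> k \<and> k < a + tape_count M then acts ! (k - a) else (s ! k, Stay)) [0..<K]))\<rparr>"

lemma embed_tm [intro!]:
  assumes "is_tm m M"
  shows "is_tm K (embed K a M)"
  unfolding is_tm_def wf_machine_def
proof (intro conjI allI impI)
  fix q and s :: "symbol list"
  assume "q < state_count (embed K a M)" "length s = tape_count (embed K a M)"
  then show "fst (trans (embed K a M) q s) \<le> state_count (embed K a M)"
    "length (snd (trans (embed K a M) q s)) = tape_count (embed K a M)"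
    using is_tmD(1)[OF assms, of q "map (\<lambda>k. s ! (a + k)) [0..<tape_count M]"] assms
    by (auto simp: embed_def is_tm_def split: prod.splits)
qed (simp add: embed_def)

lemma runs_embed:
  assumes M: "is_tm m M" and "a + m \<le> K"
    and run: "runs M n (tapes m (\<lambda>k. \<tau> (a + k))) (tapes m \<tau>')"
  shows "runs (embed K a M) n (tapes K \<tau>) (tapes K (\<lambda>k. if a \<le> k \<and> k < a + m then \<tau>' (k - a) else \<tau> k))"
proof -
  define h where "h ts = tapes K (\<lambda>k. if a \<le> k \<and> k < a + m then ts ! (k - a) else \<tau> k)" for ts
  have m: "tape_count M = m" using M by (simp add: is_tm_def)
  have "\<exists>i\<le>n. (step (embed K a M) ^^ i) (id 0, h (tapes m (\<lambda>k. \<tau> (a + k)))) = (id (state_count M), h (tapes m \<tau>'))"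
  proof (rule simulate_runs[OF M _ run])
    fix q ts q' ts'
    assume q: "q < state_count M" and ts: "length ts = m" and st: "step M (q, ts) = (q', ts')"
    obtain acts where acts: "trans M q (map (\<lambda>t. t 0) ts) = (q', acts)" "ts' = map2 update_tape acts ts"
      using q st by (auto split: prod.splits)
    have len: "length acts = m" using is_tmD(2)[OF M q, of "map (\<lambda>t. t 0) ts"] ts acts by simp
    have "map (\<lambda>k. map (\<lambda>t. t 0) (h ts) ! (a + k)) [0..<m] = map (\<lambda>t. t 0) ts"
      using assms(2) ts by (intro nth_equalityI) (auto simp: h_def)
    then show "step (embed K a M) (id q, h ts) = (id q', h ts')"
      using q acts len ts assms(2)
      by (auto simp: embed_def m h_def fun_eq_iff intro!: nth_equalityI)
  qed simp
  moreover have "h (tapes m (\<lambda>k. \<tau> (a + k))) = tapes K \<tau>"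
    by (auto simp: h_def)
  moreover have "h (tapes m \<tau>') = tapes K (\<lambda>k. if a \<le> k \<and> k < a + m then \<tau>' (k - a) else \<tau> k)"
    by (auto simp: h_def)
  ultimately show ?thesis unfolding runs_def by (simp add: embed_def)
qed

subsection \<open>Tapes as stacks\<close>

abbreviation regs :: "nat \<Rightarrow> (nat \<Rightarrow> bool list) \<Rightarrow> tape list" where
  "regs K \<sigma> \<equiv> tapes K (\<lambda>k. string_tape (\<sigma> k))"

lemma string_tape_0: "string_tape z 0 = (case z of [] \<Rightarrow> None | b # _ \<Rightarrow> Some b)"
  by (auto simp: string_tape_def split: list.split)

text \<open>The popped cell has to be blanked, for a string tape has no symbol to the left of its
  head. An empty stack stays empty, in accordance with \<open>tl [] = []\<close>.\<close>

lemma pop_string_tape: "update_tape (None, Move_Right) (string_tape z) = string_tape (tl z)"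
  by (cases z) (auto simp: string_tape_def fun_eq_iff nth_Cons' nat_add_distrib)

lemma set_string_tape: "update_tape (Some b, Stay) (string_tape z) = string_tape (b # tl z)"
  by (cases z) (auto simp: string_tape_def fun_eq_iff nth_Cons')

lemma blank_string_tape: "update_tape (None, Stay) (string_tape []) = string_tape []"
  using update_tape_stay[of "string_tape []"] by (simp only: string_tape_0 list.case)

text \<open>A push takes two steps because a machine writes before it moves.\<close>

lemma push_string_tape:
  "update_tape (Some b, Stay) (update_tape (string_tape z 0, Move_Left) (string_tape z)) = string_tape (b # z)"
  by (auto simp: string_tape_def fun_eq_iff nth_Cons' nat_diff_distrib)

lemma reads_string_tape: "reads_from_head (string_tape z) z"
  by (simp add: reads_from_head_def string_tape_def)

lemma reads_from_head_Nil: "reads_from_head t [] \<longleftrightarrow> t 0 = None"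
  by (simp add: reads_from_head_def)

text \<open>Lets the output of any machine be popped like a stack although the rest of its tape is
  unknown.\<close>

lemma reads_from_head_Cons:
  assumes "reads_from_head t (b # z)"
  shows "t 0 = Some b" "reads_from_head (update_tape (None, Move_Right) t) z"
proof -
  have *: "\<forall>i<Suc (length z). t (int i) = Some ((b # z) ! i)" "t (1 + int (length z)) = None"
    using assms by (simp_all add: reads_from_head_def add.commute)
  show "t 0 = Some b" using * by force
  have "t (int i + 1) = Some (z ! i)" if "i < length z" for i
    using *(1)[rule_format, of "Suc i"] that by (simp add: add.commute)
  then show "reads_from_head (update_tape (None, Move_Right) t) z"
    using *(2) by (simp add: reads_from_head_def add.commute)
qed

section \<open>Moving and copying strings between stacks\<close>

definition transfer :: "nat \<Rightarrow> nat \<Rightarrow> nat set \<Rightarrow> turing_machine" where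
  "transfer K i J = seq
     (basic K (\<lambda>s k. (s ! k, if k \<in> J then Move_Left else Stay)))
     (basic K (\<lambda>s k. if k = i then (None, Move_Right) else (if k \<in> J then s ! i else s ! k, Stay)))"

lemma transfer_tm [intro!]: "is_tm K (transfer K i J)"
  unfolding transfer_def by blast

text \<open>The heads in \<open>J\<close> move left first, while tape \<open>i\<close> still shows
  the symbol that the second step writes.\<close>

lemma runs_transfer:
  assumes "i < K" "i \<notin> J" "\<tau> i 0 = Some b" "\<And>k. k \<in> J \<Longrightarrow> \<tau> k = string_tape (\<sigma> k)"
  shows "runs (transfer K i J) 2 (tapes K \<tau>)
    (tapes K (\<lambda>k. if k = i then update_tape (None, Move_Right) (\<tau> i)
       else if k \<in> J then string_tape (b # \<sigma> k) else \<tau> k))"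
proof -
  define \<tau>1 where "\<tau>1 k = (if k \<in> J then update_tape (\<tau> k 0, Move_Left) (\<tau> k) else \<tau> k)" for k
  have "runs (transfer K i J) (1 + 1) (tapes K \<tau>)
    (tapes K (\<lambda>k. if k = i then update_tape (None, Move_Right) (\<tau> i)
       else if k \<in> J then string_tape (b # \<sigma> k) else \<tau> k))"
    unfolding transfer_def
  proof (rule runs_seq[OF basic_tm basic_tm])
    show "runs (basic K (\<lambda>s k. (s ! k, if k \<in> J then Move_Left else Stay))) 1 (tapes K \<tau>) (tapes K \<tau>1)"
      by (rule runs_basic) (simp add: \<tau>1_def del: update_tape.simps)
    show "runs (basic K (\<lambda>s k. if k = i then (None, Move_Right) else (if k \<in> J then s ! i else s ! k, Stay))) 1
      (tapes K \<tau>1) (tapes K (\<lambda>k. if k = i then update_tape (None, Move_Right) (\<tau> i)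
       else if k \<in> J then string_tape (b # \<sigma> k) else \<tau> k))"
      by (rule runs_basic) (use assms in \<open>auto simp: \<tau>1_def push_string_tape simp del: update_tape.simps\<close>)
  qed simp
  then show ?thesis by (simp add: numeral_2_eq_2)
qed

definition pour :: "nat \<Rightarrow> nat \<Rightarrow> nat set \<Rightarrow> turing_machine" where
  "pour K i J = loop (\<lambda>s. s ! i \<noteq> None) (transfer K i J)"

lemma pour_tm [intro!]: "is_tm K (pour K i J)"
  unfolding pour_def by blast

text \<open>Each symbol costs one test and the two steps of a transfer. The string arrives reversed;
  with empty \<open>J\<close> it is erased.\<close>

lemma runs_pour:
  assumes "i < K" "i \<notin> J" "reads_from_head (\<tau> i) z" "\<And>k. k \<in> J \<Longrightarrow> \<tau> k = string_tape (\<sigma> k)"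
  shows "runs (pour K i J) (3 * length z + 1) (tapes K \<tau>)
    (tapes K (\<lambda>k. if k = i then (update_tape (None, Move_Right) ^^ length z) (\<tau> i)
       else if k \<in> J then string_tape (rev z @ \<sigma> k) else \<tau> k))"
  using assms(3,4)
proof (induction z arbitrary: \<tau> \<sigma>)
  case Nil
  have eq: "(\<lambda>k. if k = i then (update_tape (None, Move_Right) ^^ length []) (\<tau> i)
      else if k \<in> J then string_tape (rev [] @ \<sigma> k) else \<tau> k) = \<tau>"
    using Nil by auto
  have "runs (pour K i J) 1 (tapes K \<tau>) (tapes K \<tau>)"
    unfolding pour_def using Nil assms(1) by (intro runs_loop_done) (simp add: reads_from_head_Nil)
  then show ?case unfolding eq by simp
next
  case (Cons b z)
  define \<tau>1 where "\<tau>1 k = (if k = i then update_tape (None, Move_Right) (\<tau> i)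
       else if k \<in> J then string_tape (b # \<sigma> k) else \<tau> k)" for k
  note b = reads_from_head_Cons[OF Cons.prems(1)]
  have "runs (pour K i J) (Suc (2 + (3 * length z + 1))) (tapes K \<tau>)
    (tapes K (\<lambda>k. if k = i then (update_tape (None, Move_Right) ^^ length z) (\<tau>1 i)
       else if k \<in> J then string_tape (rev z @ b # \<sigma> k) else \<tau>1 k))"
    unfolding pour_def
  proof (rule runs_loop_step[OF transfer_tm])
    show "runs (transfer K i J) 2 (tapes K \<tau>) (tapes K \<tau>1)"
      unfolding \<tau>1_def by (rule runs_transfer) (use assms(1,2) b(1) Cons.prems(2) in auto)
    show "runs (loop (\<lambda>s. s ! i \<noteq> None) (transfer K i J)) (3 * length z + 1) (tapes K \<tau>1)
     (tapes K (\<lambda>k. if k = i then (update_tape (None, Move_Right) ^^ length z) (\<tau>1 i)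
       else if k \<in> J then string_tape (rev z @ b # \<sigma> k) else \<tau>1 k))"
      unfolding pour_def[symmetric]
      by (rule Cons.IH) (use b(2) assms(2) in \<open>auto simp: \<tau>1_def simp del: update_tape.simps\<close>)
  qed (use b assms(1) in simp_all)
  moreover have "(\<lambda>k. if k = i then (update_tape (None, Move_Right) ^^ length z) (\<tau>1 i)
       else if k \<in> J then string_tape (rev z @ b # \<sigma> k) else \<tau>1 k) =
    (\<lambda>k. if k = i then (update_tape (None, Move_Right) ^^ length (b # z)) (\<tau> i)
       else if k \<in> J then string_tape (rev (b # z) @ \<sigma> k) else \<tau> k)"
    by (auto simp: \<tau>1_def funpow_swap1 simp del: update_tape.simps)
  ultimately show ?case by (simp add: eval_nat_numeral)
qed

lemma pop_all_string_tape:
  "(update_tape (None, Move_Right) ^^ length z) (string_tape z) = string_tape []"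
  by (induction z) (simp_all add: funpow_Suc_right pop_string_tape del: funpow.simps update_tape.simps)

lemma runs_pour_string:
  assumes "i < K" "i \<notin> J" "\<tau> i = string_tape z" "\<And>k. k \<in> J \<Longrightarrow> \<tau> k = string_tape (\<sigma> k)"
  shows "runs (pour K i J) (3 * length z + 1) (tapes K \<tau>)
    (tapes K (\<lambda>k. if k = i then string_tape []
       else if k \<in> J then string_tape (rev z @ \<sigma> k) else \<tau> k))"
proof -
  have "reads_from_head (\<tau> i) z" by (simp add: assms(3) reads_string_tape)
  from runs_pour[of i K J \<tau> z \<sigma>, OF assms(1,2) this assms(4)]
  show ?thesis by (simp add: assms(3) pop_all_string_tape cong: if_cong)
qed

text \<open>Two reversals cancel: from the scratch tape \<open>l\<close> the string returns in its
  original order to both \<open>i\<close> and \<open>j\<close>.\<close>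

definition dup :: "nat \<Rightarrow> nat \<Rightarrow> nat \<Rightarrow> nat \<Rightarrow> turing_machine" where
  "dup K l i j = seq (pour K i {l}) (pour K l {i, j})"

lemma dup_tm [intro!]: "is_tm K (dup K l i j)"
  unfolding dup_def by blast

lemma runs_dup:
  assumes "i < K" "l < K" "distinct [i, j, l]"
    and "\<tau> i = string_tape z" "\<tau> j = string_tape y" "\<tau> l = string_tape []"
  shows "runs (dup K l i j) (6 * length z + 2) (tapes K \<tau>) (tapes K (\<tau>(j := string_tape (z @ y))))"
proof -
  define \<tau>1 where "\<tau>1 k = (if k = i then string_tape []
       else if k \<in> {l} then string_tape (rev z @ []) else \<tau> k)" for k
  have "runs (pour K l {i, j}) (3 * length (rev z) + 1) (tapes K \<tau>1) (tapes K (\<lambda>k. if k = l then string_tape []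
       else if k \<in> {i, j} then string_tape (rev (rev z) @ (if k = i then [] else y)) else \<tau>1 k))"
    by (rule runs_pour_string) (use assms in \<open>auto simp: \<tau>1_def\<close>)
  moreover have "(\<lambda>k. if k = l then string_tape []
       else if k \<in> {i, j} then string_tape (rev (rev z) @ (if k = i then [] else y)) else \<tau>1 k) =
     \<tau>(j := string_tape (z @ y))"
    using assms by (auto simp: \<tau>1_def fun_eq_iff)
  moreover have "runs (pour K i {l}) (3 * length z + 1) (tapes K \<tau>) (tapes K \<tau>1)"
    unfolding \<tau>1_def by (rule runs_pour_string) (use assms in auto)
  ultimately have "runs (dup K l i j) (3 * length z + 1 + (3 * length (rev z) + 1)) (tapes K \<tau>)
    (tapes K (\<tau>(j := string_tape (z @ y))))"
    unfolding dup_def by (intro runs_seq[OF pour_tm pour_tm]) auto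
  then show ?thesis by simp
qed

definition move_string :: "nat \<Rightarrow> nat \<Rightarrow> nat \<Rightarrow> nat \<Rightarrow> turing_machine" where
  "move_string K l i j = seq (pour K i {l}) (pour K l {j})"

lemma move_string_tm [intro!]: "is_tm K (move_string K l i j)"
  unfolding move_string_def by blast

text \<open>The source may be the output tape of a machine; what remains there beyond the output is
  left unspecified as \<open>t\<close>.\<close>

lemma runs_move_string:
  assumes "i < K" "l < K" "distinct [i, j, l]"
    and "reads_from_head (\<tau> i) z" "\<tau> j = string_tape y" "\<tau> l = string_tape []"
  obtains t where "runs (move_string K l i j) (6 * length z + 2) (tapes K \<tau>)
    (tapes K (\<tau>(i := t, j := string_tape (z @ y))))"
proof -
  define t where "t = (update_tape (None, Move_Right) ^^ length z) (\<tau> i)"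
  define \<tau>1 where "\<tau>1 k = (if k = i then t
       else if k \<in> {l} then string_tape (rev z @ []) else \<tau> k)" for k
  have "runs (pour K l {j}) (3 * length (rev z) + 1) (tapes K \<tau>1) (tapes K (\<lambda>k. if k = l then string_tape []
       else if k \<in> {j} then string_tape (rev (rev z) @ y) else \<tau>1 k))"
    by (rule runs_pour_string) (use assms in \<open>auto simp: \<tau>1_def\<close>)
  moreover have "(\<lambda>k. if k = l then string_tape []
       else if k \<in> {j} then string_tape (rev (rev z) @ y) else \<tau>1 k) =
     \<tau>(i := t, j := string_tape (z @ y))"
    using assms by (auto simp: \<tau>1_def fun_eq_iff)
  moreover have "runs (pour K i {l}) (3 * length z + 1) (tapes K \<tau>) (tapes K \<tau>1)"
    unfolding \<tau>1_def t_def by (rule runs_pour) (use assms in auto)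
  ultimately have "runs (move_string K l i j) (3 * length z + 1 + (3 * length (rev z) + 1)) (tapes K \<tau>)
    (tapes K (\<tau>(i := t, j := string_tape (z @ y))))"
    unfolding move_string_def by (intro runs_seq[OF pour_tm pour_tm]) auto
  then show ?thesis using that by simp
qed

definition noop :: "nat \<Rightarrow> turing_machine" where
  "noop K = \<lparr>tape_count = K, state_count = 0, trans = (\<lambda>q s. (0, []))\<rparr>"

lemma noop_tm [intro!]: "is_tm K (noop K)"
  by (simp add: is_tm_def wf_machine_def noop_def)

lemma runs_noop: "runs (noop K) 0 ts ts"
  unfolding runs_def by (simp add: noop_def)

fun copies :: "nat \<Rightarrow> nat \<Rightarrow> nat \<Rightarrow> nat list \<Rightarrow> turing_machine" where
  "copies K l d [] = noop K"
| "copies K l d (i # is) = seq (dup K l i d) (copies K l (Suc d) is)"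

lemma copies_tm [intro!]: "is_tm K (copies K l d is)"
  by (induction "is" arbitrary: d) auto

lemma runs_copies:
  assumes "l < d" "d + length is \<le> K" "\<tau> l = string_tape []"
    and "\<And>i. i \<in> set is \<Longrightarrow> i < d \<and> i \<noteq> l \<and> \<tau> i = string_tape (\<sigma> i)"
    and "\<And>k. d \<le> k \<Longrightarrow> k < d + length is \<Longrightarrow> \<tau> k = string_tape []"
  shows "runs (copies K l d is) (\<Sum>i\<leftarrow>is. 6 * length (\<sigma> i) + 2) (tapes K \<tau>)
    (tapes K (\<lambda>k. if d \<le> k \<and> k < d + length is then string_tape (\<sigma> (is ! (k - d))) else \<tau> k))"
  using assms
proof (induction "is" arbitrary: d \<tau>)
  case Nil
  have "(\<lambda>k. if d \<le> k \<and> k < d + length [] then string_tape (\<sigma> ([] ! (k - d))) else \<tau> k) = \<tau>"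
    by (auto simp: fun_eq_iff)
  then show ?case by (simp add: runs_noop)
next
  case (Cons i "is")
  have i: "i < d" "i \<noteq> l" "\<tau> i = string_tape (\<sigma> i)" using Cons.prems(4)[of i] by simp_all
  define \<tau>1 where "\<tau>1 = \<tau>(d := string_tape (\<sigma> i @ []))"
  define \<tau>2 where "\<tau>2 k = (if Suc d \<le> k \<and> k < Suc d + length is then string_tape (\<sigma> (is ! (k - Suc d))) else \<tau>1 k)" for k
  have r1: "runs (dup K l i d) (6 * length (\<sigma> i) + 2) (tapes K \<tau>) (tapes K \<tau>1)"
    unfolding \<tau>1_def by (rule runs_dup) (use i Cons.prems(1-3) Cons.prems(5)[of d] in auto)
  have r2: "runs (copies K l (Suc d) is) (\<Sum>i\<leftarrow>is. 6 * length (\<sigma> i) + 2) (tapes K \<tau>1) (tapes K \<tau>2)"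
    unfolding \<tau>2_def by (rule Cons.IH) (use Cons.prems in \<open>force simp: \<tau>1_def\<close>)+
  have eq: "\<tau>2 = (\<lambda>k. if d \<le> k \<and> k < d + length (i # is) then string_tape (\<sigma> ((i # is) ! (k - d))) else \<tau> k)"
    by (auto simp: \<tau>2_def \<tau>1_def fun_eq_iff nth_Cons')
  have "length (tapes K \<tau>) = K" by simp
  from runs_seq[OF dup_tm copies_tm this r1 r2] show ?case unfolding eq by simp
qed

subsection \<open>Composition of polynomial-time functions\<close>

definition inits :: "bool list list \<Rightarrow> nat \<Rightarrow> bool list" where
  "inits xs k = (if k < length xs then xs ! k else [])"

abbreviation total_length :: "bool list list \<Rightarrow> nat" where
  "total_length xs \<equiv> sum_list (map length xs)"

lemma initial_config_regs:
  assumes "length xs \<le> tape_count M"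
  shows "initial_config M xs = (0, regs (tape_count M) (inits xs))"
  unfolding initial_config_def using assms
  by (auto simp: inits_def nth_append intro!: nth_equalityI)

lemma polytimeI:
  assumes "is_tm K M" "1 \<le> K" "k \<le> K" "polynomial_fun t"
    and "\<And>xs. length xs = k \<Longrightarrow> \<exists>\<tau>. runs M (t (total_length xs)) (regs K (inits xs)) (tapes K \<tau>) \<and>
      reads_from_head (\<tau> 0) (F xs)"
  shows "polytime k F"
  unfolding polytime_def
proof (intro exI[of _ M] exI[of _ t] conjI allI impI)
  have K: "tape_count M = K" "wf_machine M" using assms(1) by (simp_all add: is_tm_def)
  then show "wf_machine M" "1 \<le> tape_count M" "k \<le> tape_count M" "polynomial_fun t"
    using assms by simp_all
  fix xs :: "bool list list"
  assume xs: "length xs = k"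
  then obtain \<tau> j where j: "j \<le> t (total_length xs)"
    "(step M ^^ j) (0, regs K (inits xs)) = (state_count M, tapes K \<tau>)" "reads_from_head (\<tau> 0) (F xs)"
    using assms(5) unfolding runs_def by blast
  \<comment> \<open>Idle steps in the halting state make up the exact number of steps that
    \<open>outputs_within\<close> asks for.\<close>
  have "(step M ^^ (t (total_length xs) - j + j)) (0, regs K (inits xs)) = (state_count M, tapes K \<tau>)"
    unfolding funpow_add comp_apply j(2) steps_halted ..
  then show "outputs_within M xs (t (total_length xs)) (F xs)"
    using j xs assms(2,3) by (simp add: outputs_within_def initial_config_regs K hd_map)
qed

text \<open>In coordinates relative to the head, a step moves old symbols at most one cell to the
  right, and the cell just written ends up at most at cell 1. So no symbol lies beyond cell
  \<open>total_length xs + n\<close>.\<close>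

lemma output_length:
  assumes "is_tm K M" "1 \<le> K" "length xs \<le> K" "runs M n (regs K (inits xs)) (tapes K \<tau>)"
    and "reads_from_head (\<tau> 0) y"
  shows "length y \<le> total_length xs + n + 1"
proof -
  define L where "L = int (total_length xs)"
  have "\<forall>t\<in>set (snd ((step M ^^ j) (0, regs K (inits xs)))). \<forall>i. t i \<noteq> None \<longrightarrow> i \<le> L + int j" for j
  proof (induction j)
    case 0
    have "length (inits xs k) \<le> total_length xs" for k
      unfolding inits_def by (auto intro: member_le_sum_list)
    then have "i \<le> L" if "string_tape (inits xs k) i \<noteq> None" for i k
      using that[unfolded string_tape_def] order.trans unfolding L_def
      by (smt (verit) of_nat_le_iff)
    then show ?case by auto
  next
    case (Suc j)
    obtain q ts where c: "(step M ^^ j) (0, regs K (inits xs)) = (q, ts)" by fastforce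
    have upd: "i \<le> L + int (Suc j)"
      if "t \<in> set ts" "update_tape a t i \<noteq> None" for a t i
    proof -
      obtain b d where a: "a = (b, d)" by fastforce
      show ?thesis
      proof (cases "i + head_offset d = 0")
        case True
        then show ?thesis by (cases d) (simp_all add: L_def)
      next
        case False
        then have "t (i + head_offset d) \<noteq> None" using that(2) a by simp
        then have "i + head_offset d \<le> L + int j" using Suc.IH that(1) c by simp
        then show ?thesis by (cases d) simp_all
      qed
    qed
    have "set (snd (step M (q, ts))) \<subseteq> set ts \<union> {update_tape a t | a t. t \<in> set ts}"
      by (auto split: prod.splits dest: set_zip_rightD simp del: update_tape.simps)
    then have "set (snd ((step M ^^ Suc j) (0, regs K (inits xs)))) \<subseteq>
        set ts \<union> {update_tape a t | a t. t \<in> set ts}"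
      by (simp add: c del: step.simps update_tape.simps)
    moreover have "i \<le> L + int (Suc j)" if "t \<in> set ts" "t i \<noteq> None" for t i
      using Suc.IH that c by fastforce
    ultimately show ?case using upd by blast
  qed
  moreover obtain j where j: "j \<le> n" "(step M ^^ j) (0, regs K (inits xs)) = (state_count M, tapes K \<tau>)"
    using assms(4) unfolding runs_def by blast
  ultimately have "\<tau> 0 i \<noteq> None \<longrightarrow> i \<le> L + int j" for i
    using assms(2) by (metis (no_types, lifting) atLeastLessThan_iff imageI le0 less_eq_Suc_le One_nat_def set_map set_upt snd_conv)
  then have *: "\<tau> 0 (int i) = Some (y ! i) \<Longrightarrow> int i \<le> L + int j" for i by auto
  show ?thesis
  proof (cases y)
    case (Cons b z)
    then have "int (length z) \<le> L + int j" using assms(5) *[of "length z"]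
      by (simp add: reads_from_head_def)
    then show ?thesis using j(1) Cons by (simp add: L_def)
  qed simp
qed

text \<open>Trades the given time bound for a monotone one that also dominates the output length: in
  a composition the second bound is evaluated at an estimate of the intermediate lengths.\<close>

lemma polytimeE:
  assumes "polytime k F"
  obtains K M t where "is_tm K M" "1 \<le> K" "k \<le> K" "mono t" "polynomial_fun t"
    "\<And>xs. length xs = k \<Longrightarrow> \<exists>\<tau>. runs M (t (total_length xs)) (regs K (inits xs)) (tapes K \<tau>) \<and>
      reads_from_head (\<tau> 0) (F xs)"
    "\<And>xs. length xs = k \<Longrightarrow> length (F xs) \<le> t (total_length xs)"
proof -
  obtain M t where M: "wf_machine M" "1 \<le> tape_count M" "k \<le> tape_count M" "polynomial_fun t"
    "\<And>xs. length xs = k \<Longrightarrow> outputs_within M xs (t (total_length xs)) (F xs)"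
    using assms unfolding polytime_def by blast
  define K where "K = tape_count M"
  have tm: "is_tm K M" using M(1) by (simp add: is_tm_def K_def)
  have "polynomial_fun (\<lambda>n. n + t n + 1)"
    by (intro polynomial_fun_add polynomial_fun_id polynomial_fun_const M)
  then obtain cs where cs: "n + t n + 1 \<le> newton cs n" for n
    using polynomial_fun_le_newton by blast
  have runs: "\<exists>\<tau>. runs M (t (total_length xs)) (regs K (inits xs)) (tapes K \<tau>) \<and> reads_from_head (\<tau> 0) (F xs)"
    if xs: "length xs = k" for xs
  proof -
    obtain ts where ts: "(step M ^^ t (total_length xs)) (0, regs K (inits xs)) = (state_count M, ts)"
      "reads_from_head (hd ts) (F xs)"
      using M(5)[OF xs] M(3) xs
      by (auto simp: outputs_within_def initial_config_regs K_def split: prod.splits)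
    then have r: "runs M (t (total_length xs)) (regs K (inits xs)) ts" unfolding runs_def by blast
    have "length ts = K" by (rule runs_length[OF tm _ r]) simp
    then have "ts = tapes K (nth ts)" "hd ts = ts ! 0"
      using M(2) map_nth[of ts] by (auto simp: K_def intro!: hd_conv_nth)
    then show ?thesis using r ts by metis
  qed
  show ?thesis
  proof (rule that[OF tm _ _ mono_newton polynomial_fun_newton])
    fix xs :: "bool list list"
    assume xs: "length xs = k"
    obtain \<tau> where \<tau>: "runs M (t (total_length xs)) (regs K (inits xs)) (tapes K \<tau>)"
      "reads_from_head (\<tau> 0) (F xs)" using runs[OF xs] by blast
    then show "\<exists>\<tau>. runs M (newton cs (total_length xs)) (regs K (inits xs)) (tapes K \<tau>) \<and> reads_from_head (\<tau> 0) (F xs)"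
      using runs_mono[OF \<tau>(1)] cs[of "total_length xs"] by (meson add_leE order_trans)
    show "length (F xs) \<le> newton cs (total_length xs)"
      using output_length[OF tm _ _ \<tau>] xs M(2,3) cs[of "total_length xs"] by (simp add: K_def)
  qed (use M in \<open>auto simp: K_def\<close>)
qed

text \<open>The one composition carried out on machines; reindexing, additional arguments and
  general composition are derived from it, since \<open>js\<close> may permute, repeat or omit
  arguments.\<close>

lemma polytime_let:
  assumes "polytime m G" "polytime (length js) F" "\<And>j. j \<in> set js \<Longrightarrow> j \<le> m"
  shows "polytime m (\<lambda>xs. F (map (nth (xs @ [G xs])) js))"
proof -
  from assms(1) obtain g MG tG where MG: "is_tm g MG" "1 \<le> g" "m \<le> g" "mono tG" "polynomial_fun tG"
    "\<And>xs. length xs = m \<Longrightarrow> \<exists>\<tau>. runs MG (tG (total_length xs)) (regs g (inits xs)) (tapes g \<tau>) \<and>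
      reads_from_head (\<tau> 0) (G xs)"
    "\<And>xs. length xs = m \<Longrightarrow> length (G xs) \<le> tG (total_length xs)"
    by (rule polytimeE) blast
  from assms(2) obtain f MF tF where MF: "is_tm f MF" "1 \<le> f" "length js \<le> f" "mono tF" "polynomial_fun tF"
    "\<And>xs. length xs = length js \<Longrightarrow> \<exists>\<tau>. runs MF (tF (total_length xs)) (regs f (inits xs)) (tapes f \<tau>) \<and>
      reads_from_head (\<tau> 0) (F xs)"
    "\<And>xs. length xs = length js \<Longrightarrow> length (F xs) \<le> tF (total_length xs)"
    by (rule polytimeE) blast
  \<comment> \<open>Tapes below \<open>m\<close> hold the arguments, tape \<open>m\<close> receives
    the value of \<open>G\<close>, tape \<open>m + 1\<close> is scratch; the blocks from
    \<open>a\<close> and \<open>b\<close> on belong to the two machines.\<close>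
  define a where "a = m + 2"
  define b where "b = a + g"
  define K where "K = b + f"
  \<comment> \<open>Tape 0 is emptied before the last move because \<open>move_string\<close> puts
    the string on top of what is already there.\<close>
  define P where "P = seq (copies K (m + 1) a [0..<m]) (seq (embed K a MG) (seq (move_string K (m + 1) a m)
    (seq (copies K (m + 1) b js) (seq (embed K b MF) (seq (pour K 0 {}) (move_string K (m + 1) b 0))))))"
  \<comment> \<open>A bound for each entry of \<open>xs @ [G xs]\<close> when the total length is
    \<open>n\<close>.\<close>
  define s where "s = (\<lambda>n. n + tG n)"
  define t where "t = (\<lambda>n. (6 * n + 2 * m) + (tG n + ((6 * tG n + 2) + (length js * (6 * s n + 2) +
    (tF (length js * s n) + ((3 * s n + 1) + (6 * tF (length js * s n) + 2))))))) "
  have s: "polynomial_fun s" unfolding s_def by (intro polynomial_fun_add polynomial_fun_id MG)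
  have "polynomial_fun t" unfolding t_def
    by (intro polynomial_fun_add polynomial_fun_mult polynomial_fun_id polynomial_fun_const
      polynomial_fun_compose[OF MF(5)] MG(5) s)
  moreover have tm: "is_tm K P" unfolding P_def using MG(1) MF(1) by blast
  moreover have "\<exists>\<tau>. runs P (t (total_length xs)) (regs K (inits xs)) (tapes K \<tau>) \<and>
      reads_from_head (\<tau> 0) (F (map (nth (xs @ [G xs])) js))" if xs: "length xs = m" for xs
  proof -
    define n where "n = total_length xs"
    define z where "z = G xs"
    define ws where "ws = xs @ [z]"
    define ys where "ys = map (nth ws) js"
    have ws: "length (ws ! i) \<le> s n" if "i \<le> m" for i
    proof (cases "i < m")
      case True
      then have "length (xs ! i) \<le> n" unfolding n_def by (intro member_le_sum_list) (simp_all add: xs)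
      then show ?thesis using True xs by (simp add: ws_def nth_append s_def)
    next
      case False
      then show ?thesis using MG(7)[OF xs] that xs by (simp add: ws_def nth_append s_def z_def n_def)
    qed
    have ys_le: "total_length ys \<le> length js * s n"
    proof -
      have "(\<Sum>j\<leftarrow>js. length (ws ! j)) \<le> (\<Sum>j\<leftarrow>js. s n)"
        using ws assms(3) by (intro sum_list_mono) simp
      then show ?thesis by (simp add: ys_def comp_def sum_list_triv)
    qed
    obtain \<gamma> where \<gamma>: "runs MG (tG n) (regs g (inits xs)) (tapes g \<gamma>)" "reads_from_head (\<gamma> 0) z"
      using MG(6)[OF xs] unfolding n_def z_def by blast
    have "length ys = length js" by (simp add: ys_def)
    from MF(6)[OF this] obtain \<phi> where \<phi>: "runs MF (tF (total_length ys)) (regs f (inits ys)) (tapes f \<phi>)"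
      "reads_from_head (\<phi> 0) (F ys)" by blast
    have Fys: "tF (total_length ys) \<le> tF (length js * s n)" "length (F ys) \<le> tF (length js * s n)"
      using monoD[OF MF(4) ys_le] MF(7)[of ys] \<open>length ys = length js\<close> by simp_all
    define \<tau>0 where "\<tau>0 k = string_tape (inits xs k)" for k
    define \<tau>1 where "\<tau>1 k = (if a \<le> k \<and> k < a + length [0..<m] then string_tape (xs ! ([0..<m] ! (k - a))) else \<tau>0 k)" for k
    define \<tau>2 where "\<tau>2 k = (if a \<le> k \<and> k < a + g then \<gamma> (k - a) else \<tau>1 k)" for k
    have "runs (copies K (m + 1) a [0..<m]) (\<Sum>i\<leftarrow>[0..<m]. 6 * length (xs ! i) + 2) (tapes K \<tau>0) (tapes K \<tau>1)"
      unfolding \<tau>1_def by (rule runs_copies) (use xs MG(3) in \<open>auto simp: \<tau>0_def inits_def a_def b_def K_def\<close>)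
    moreover have "(\<Sum>i\<leftarrow>[0..<m]. 6 * length (xs ! i) + 2) = 6 * n + 2 * m"
      using xs by (simp add: n_def sum_list_sum_nth atLeast0LessThan sum.distrib sum_distrib_left del: add_2_eq_Suc')
    ultimately have r1: "runs (copies K (m + 1) a [0..<m]) (6 * n + 2 * m) (tapes K \<tau>0) (tapes K \<tau>1)" by simp
    have eq: "regs g (inits xs) = tapes g (\<lambda>k. \<tau>1 (a + k))"
      using xs by (auto simp: \<tau>1_def \<tau>0_def inits_def a_def)
    have r2: "runs (embed K a MG) (tG n) (tapes K \<tau>1) (tapes K \<tau>2)"
      unfolding \<tau>2_def by (rule runs_embed[OF MG(1) _ \<gamma>(1)[unfolded eq]]) (simp add: K_def b_def)
    obtain t2 where r3: "runs (move_string K (m + 1) a m) (6 * length z + 2) (tapes K \<tau>2)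
      (tapes K (\<tau>2(a := t2, m := string_tape (z @ []))))"
      by (rule runs_move_string[of a K "m + 1" m \<tau>2 z "[]"])
        (use xs \<gamma>(2) MG(2) MF(2) in \<open>auto simp: \<tau>2_def \<tau>1_def \<tau>0_def inits_def a_def b_def K_def\<close>)
    define \<tau>3 where "\<tau>3 = \<tau>2(a := t2, m := string_tape (z @ []))"
    have \<tau>3: "\<tau>3 k = string_tape (ws ! k)" if "k \<le> m" for k
      using that xs by (auto simp: \<tau>3_def \<tau>2_def \<tau>1_def \<tau>0_def inits_def a_def ws_def nth_append)
    define \<tau>4 where "\<tau>4 k = (if b \<le> k \<and> k < b + length js then string_tape (ws ! (js ! (k - b))) else \<tau>3 k)" for k
    have r4: "runs (copies K (m + 1) b js) (\<Sum>i\<leftarrow>js. 6 * length (ws ! i) + 2) (tapes K \<tau>3) (tapes K \<tau>4)"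
      unfolding \<tau>4_def
      by (rule runs_copies)
        (use assms(3) \<tau>3 xs MG(2,3) MF(3) in \<open>fastforce simp: \<tau>3_def \<tau>2_def \<tau>1_def \<tau>0_def inits_def a_def b_def K_def\<close>)+
    have "(\<Sum>i\<leftarrow>js. 6 * length (ws ! i) + 2) \<le> (\<Sum>i\<leftarrow>js. 6 * s n + 2)"
      using ws assms(3) by (intro sum_list_mono) simp
    then have "(\<Sum>i\<leftarrow>js. 6 * length (ws ! i) + 2) \<le> length js * (6 * s n + 2)"
      by (simp add: sum_list_triv)
    then have r4: "runs (copies K (m + 1) b js) (length js * (6 * s n + 2)) (tapes K \<tau>3) (tapes K \<tau>4)"
      using runs_mono[OF r4] by blast
    define \<tau>5 where "\<tau>5 k = (if b \<le> k \<and> k < b + f then \<phi> (k - b) else \<tau>4 k)" for k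
    have eq: "regs f (inits ys) = tapes f (\<lambda>k. \<tau>4 (b + k))"
      using xs MG(2,3) by (auto simp: \<tau>4_def \<tau>3_def \<tau>2_def \<tau>1_def \<tau>0_def inits_def ys_def a_def b_def)
    have r5: "runs (embed K b MF) (tF (total_length ys)) (tapes K \<tau>4) (tapes K \<tau>5)"
      unfolding \<tau>5_def by (rule runs_embed[OF MF(1) _ \<phi>(1)[unfolded eq]]) (simp add: K_def)
    define \<tau>6 where "\<tau>6 k = (if k = 0 then string_tape [] else if k \<in> {} then string_tape (rev (ws ! 0) @ []) else \<tau>5 k)" for k
    \<comment> \<open>For \<open>m = 0\<close>, tape 0 holds the value of \<open>G\<close>;
      \<open>ws ! 0\<close> covers both cases.\<close>
    have r6: "runs (pour K 0 {}) (3 * length (ws ! 0) + 1) (tapes K \<tau>5) (tapes K \<tau>6)"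
      unfolding \<tau>6_def by (rule runs_pour_string[where \<sigma> = "\<lambda>_. []"]) (use \<tau>3[of 0] MG(2) in \<open>auto simp: \<tau>5_def \<tau>4_def a_def b_def K_def\<close>)
    obtain t6 where r7: "runs (move_string K (m + 1) b 0) (6 * length (F ys) + 2) (tapes K \<tau>6)
      (tapes K (\<tau>6(b := t6, 0 := string_tape (F ys @ []))))"
      by (rule runs_move_string[of b K "m + 1" 0 \<tau>6 "F ys" "[]"])
        (use xs \<phi>(2) MF(2) MG(2) in \<open>auto simp: \<tau>6_def \<tau>5_def \<tau>4_def \<tau>3_def \<tau>2_def \<tau>1_def \<tau>0_def inits_def a_def b_def K_def\<close>)
    have "runs P (t n) (tapes K \<tau>0) (tapes K (\<tau>6(b := t6, 0 := string_tape (F ys @ []))))"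
      unfolding P_def t_def
    proof (intro runs_seq)
      show "runs (copies K (m + 1) a [0..<m]) (6 * n + 2 * m) (tapes K \<tau>0) (tapes K \<tau>1)" by (rule r1)
      show "runs (embed K a MG) (tG n) (tapes K \<tau>1) (tapes K \<tau>2)" by (rule r2)
      show "runs (move_string K (m + 1) a m) (6 * tG n + 2) (tapes K \<tau>2) (tapes K \<tau>3)"
        using MG(7)[OF xs] by (intro runs_mono[OF r3[folded \<tau>3_def]]) (simp add: z_def n_def)
      show "runs (copies K (m + 1) b js) (length js * (6 * s n + 2)) (tapes K \<tau>3) (tapes K \<tau>4)" by (rule r4)
      show "runs (embed K b MF) (tF (length js * s n)) (tapes K \<tau>4) (tapes K \<tau>5)"
        using Fys by (intro runs_mono[OF r5])
      show "runs (pour K 0 {}) (3 * s n + 1) (tapes K \<tau>5) (tapes K \<tau>6)"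
        using ws[of 0] by (intro runs_mono[OF r6]) simp
      show "runs (move_string K (m + 1) b 0) (6 * tF (length js * s n) + 2) (tapes K \<tau>6)
        (tapes K (\<tau>6(b := t6, 0 := string_tape (F ys @ []))))"
        using Fys by (intro runs_mono[OF r7]) simp
    qed (use MG(1) MF(1) in auto)
    moreover have "reads_from_head ((\<tau>6(b := t6, 0 := string_tape (F ys @ []))) 0) (F ys)"
      by (simp add: reads_string_tape)
    ultimately show ?thesis unfolding \<tau>0_def[abs_def] n_def ys_def ws_def z_def by blast
  qed
  ultimately show ?thesis using MG(2,3) by (intro polytimeI[of K P]) (auto simp: K_def b_def a_def)
qed

lemma polytime_cong:
  assumes "polytime k F" "\<And>xs. length xs = k \<Longrightarrow> F xs = F' xs"
  shows "polytime k F'"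
  using assms unfolding polytime_def by metis

lemma polytime_first: "polytime m (\<lambda>xs. inits xs 0)"
proof (rule polytimeI[of "max 1 m" "noop (max 1 m)" m "\<lambda>_. 0"])
  fix xs :: "bool list list"
  show "\<exists>\<tau>. runs (noop (max 1 m)) 0 (regs (max 1 m) (inits xs)) (tapes (max 1 m) \<tau>) \<and>
      reads_from_head (\<tau> 0) (inits xs 0)"
    by (intro exI[of _ "\<lambda>k. string_tape (inits xs k)"]) (simp add: runs_noop reads_string_tape)
qed auto

text \<open>The intermediate value in \<open>polytime_let\<close> is a dummy here: indices below
  \<open>m\<close> never select it.\<close>

lemma polytime_reindex:
  assumes "polytime (length js) F" "\<And>j. j \<in> set js \<Longrightarrow> j < m"
  shows "polytime m (\<lambda>xs. F (map (nth xs) js))"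
proof (rule polytime_cong)
  show "polytime m (\<lambda>xs. F (map (nth (xs @ [inits xs 0])) js))"
    using assms by (intro polytime_let polytime_first) (auto intro: less_imp_le)
  fix xs :: "bool list list"
  assume "length xs = m"
  then have eq: "map (nth (xs @ [inits xs 0])) js = map (nth xs) js"
    using assms(2) by (simp add: nth_append)
  show "F (map (nth (xs @ [inits xs 0])) js) = F (map (nth xs) js)" unfolding eq ..
qed

lemma polytime_nth:
  assumes "i < m"
  shows "polytime m (\<lambda>xs. xs ! i)"
  using polytime_reindex[of "[i]" "\<lambda>xs. inits xs 0" m] assms polytime_first[of "Suc 0"]
  by (simp add: inits_def)

text \<open>The values go behind the arguments, so that each \<open>G\<close> still finds these in
  the first \<open>m\<close> places. The induction absorbs the last \<open>G\<close> into
  \<open>F\<close>.\<close>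

lemma polytime_append_args:
  assumes "\<And>G. G \<in> set Gs \<Longrightarrow> polytime m G" "polytime (m + length Gs) F"
  shows "polytime m (\<lambda>xs. F (xs @ map (\<lambda>G. G xs) Gs))"
  using assms
proof (induction Gs arbitrary: F rule: rev_induct)
  case (snoc G Gs)
  define n where "n = m + length Gs"
  have "polytime n (\<lambda>ys. G (map (nth ys) [0..<m]))"
    using snoc.prems(1)[of G] by (intro polytime_reindex) (simp_all add: n_def)
  then have "polytime n (\<lambda>ys. F (map (nth (ys @ [G (map (nth ys) [0..<m])])) [0..<Suc n]))"
    using snoc.prems(2) by (intro polytime_let) (auto simp: n_def)
  then have "polytime n (\<lambda>ys. F (ys @ [G (take m ys)]))"
  proof (rule polytime_cong)
    fix ys :: "bool list list"
    assume ys: "length ys = n"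
    have "map (nth ys) [0..<m] = take m ys"
      using ys by (intro nth_equalityI) (simp_all add: n_def)
    moreover have "map (nth (ys @ [z])) [0..<Suc n] = ys @ [z]" for z
      using map_nth[of "ys @ [z]"] ys by simp
    ultimately show "F (map (nth (ys @ [G (map (nth ys) [0..<m])])) [0..<Suc n]) = F (ys @ [G (take m ys)])"
      by simp
  qed
  then have "polytime m (\<lambda>xs. F ((xs @ map (\<lambda>G. G xs) Gs) @ [G (take m (xs @ map (\<lambda>G. G xs) Gs))]))"
    using snoc.prems(1) by (intro snoc.IH) (simp_all add: n_def)
  then show ?case by (rule polytime_cong) simp
qed simp

lemma polytime_comp:
  assumes "polytime (length Gs) F" "\<And>G. G \<in> set Gs \<Longrightarrow> polytime m G"
  shows "polytime m (\<lambda>xs. F (map (\<lambda>G. G xs) Gs))"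
proof -
  have "polytime (m + length Gs) (\<lambda>ys. F (map (nth ys) [m..<m + length Gs]))"
    using assms(1) by (intro polytime_reindex) simp_all
  then have "polytime m (\<lambda>xs. F (map (nth (xs @ map (\<lambda>G. G xs) Gs)) [m..<m + length Gs]))"
    using assms(2) by (intro polytime_append_args)
  then show ?thesis
  proof (rule polytime_cong)
    fix xs :: "bool list list"
    assume "length xs = m"
    then have "map (nth (xs @ map (\<lambda>G. G xs) Gs)) [m..<m + length Gs] = map (\<lambda>G. G xs) Gs"
      by (intro nth_equalityI) (simp_all add: nth_append)
    then show "F (map (nth (xs @ map (\<lambda>G. G xs) Gs)) [m..<m + length Gs]) = F (map (\<lambda>G. G xs) Gs)" by simp
  qed
qed

lemma polytime_comp1:
  assumes "polytime 1 F" "polytime m G"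
  shows "polytime m (\<lambda>xs. F [G xs])"
  using polytime_comp[of "[G]" F m] assms by simp

lemma polytime_comp2:
  assumes "polytime 2 F" "polytime m G" "polytime m H"
  shows "polytime m (\<lambda>xs. F [G xs, H xs])"
  using polytime_comp[of "[G, H]" F m] assms by (auto simp: numeral_2_eq_2)

lemma polytime_comp3:
  assumes "polytime 3 F" "polytime m G" "polytime m H" "polytime m I"
  shows "polytime m (\<lambda>xs. F [G xs, H xs, I xs])"
  using polytime_comp[of "[G, H, I]" F m] assms by (auto simp: numeral_3_eq_3)

section \<open>Machines on explicit lists of stacks\<close>

abbreviation strs :: "bool list list \<Rightarrow> tape list" where
  "strs zs \<equiv> map string_tape zs"

lemma regs_nth: "length zs = K \<Longrightarrow> regs K (nth zs) = strs zs"
  by (auto intro: nth_equalityI)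

lemma polytimeI_strs:
  assumes "is_tm K M" "1 \<le> K" "k \<le> K" "polynomial_fun t"
    and "\<And>xs. length xs = k \<Longrightarrow> \<exists>zs. length zs = K \<and> zs ! 0 = F xs \<and>
      runs M (t (total_length xs)) (strs (xs @ replicate (K - k) [])) (strs zs)"
  shows "polytime k F"
proof (rule polytimeI[OF assms(1-4)])
  fix xs :: "bool list list"
  assume xs: "length xs = k"
  then obtain zs where zs: "length zs = K" "zs ! 0 = F xs"
    "runs M (t (total_length xs)) (strs (xs @ replicate (K - k) [])) (strs zs)"
    using assms(5) by blast
  have "strs (xs @ replicate (K - k) []) = regs K (inits xs)"
    using xs assms(3) by (intro nth_equalityI) (auto simp: inits_def nth_append)
  then show "\<exists>\<tau>. runs M (t (total_length xs)) (regs K (inits xs)) (tapes K \<tau>) \<and> reads_from_head (\<tau> 0) (F xs)"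
    using zs regs_nth[OF zs(1)]
    by (intro exI[of _ "\<lambda>k. string_tape (zs ! k)"]) (simp add: reads_string_tape flip: zs(2))
qed

lemma runs_basic_strs:
  assumes "length zs = K" "length zs' = K"
    and "\<And>k. k < K \<Longrightarrow>
      update_tape (f (map (\<lambda>z. string_tape z 0) zs) k) (string_tape (zs ! k)) = string_tape (zs' ! k)"
  shows "runs (basic K f) 1 (strs zs) (strs zs')"
proof -
  have "map (\<lambda>k. string_tape (zs ! k) 0) [0..<K] = map (\<lambda>z. string_tape z 0) zs"
    using assms(1) by (intro nth_equalityI) simp_all
  then have "runs (basic K f) 1 (regs K (nth zs)) (regs K (nth zs'))"
    using assms(3) by (intro runs_basic) simp
  then show ?thesis using regs_nth assms(1,2) by simp
qed

lemma runs_transfer_strs: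
  assumes "i < K" "i \<notin> J" "length zs = K" "zs ! i = b # z"
    and "zs' = map (\<lambda>k. if k = i then z else if k \<in> J then b # zs ! k else zs ! k) [0..<K]"
  shows "runs (transfer K i J) 2 (strs zs) (strs zs')"
proof -
  have "runs (transfer K i J) 2 (regs K (nth zs)) (tapes K (\<lambda>k. if k = i then update_tape (None, Move_Right) (string_tape (zs ! i))
       else if k \<in> J then string_tape (b # zs ! k) else string_tape (zs ! k)))"
    by (rule runs_transfer) (use assms in \<open>simp_all add: string_tape_0\<close>)
  also have "regs K (nth zs) = strs zs" using assms(3) by (rule regs_nth)
  also have "tapes K (\<lambda>k. if k = i then update_tape (None, Move_Right) (string_tape (zs ! i))
       else if k \<in> J then string_tape (b # zs ! k) else string_tape (zs ! k)) = strs zs'"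
    using assms by (auto simp: pop_string_tape simp del: update_tape.simps)
  finally show ?thesis .
qed

lemma runs_pour_strs:
  assumes "i < K" "i \<notin> J" "length zs = K"
    and "zs' = map (\<lambda>k. if k = i then [] else if k \<in> J then rev (zs ! i) @ zs ! k else zs ! k) [0..<K]"
  shows "runs (pour K i J) (3 * length (zs ! i) + 1) (strs zs) (strs zs')"
proof -
  have "runs (pour K i J) (3 * length (zs ! i) + 1) (regs K (nth zs)) (tapes K (\<lambda>k. if k = i then string_tape []
       else if k \<in> J then string_tape (rev (zs ! i) @ zs ! k) else string_tape (zs ! k)))"
    by (rule runs_pour_string) (use assms in simp_all)
  also have "regs K (nth zs) = strs zs" using assms(3) by (rule regs_nth)
  also have "tapes K (\<lambda>k. if k = i then string_tape []
       else if k \<in> J then string_tape (rev (zs ! i) @ zs ! k) else string_tape (zs ! k)) = strs zs'"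
    using assms by auto
  finally show ?thesis .
qed

definition push :: "nat \<Rightarrow> nat \<Rightarrow> bool \<Rightarrow> turing_machine" where
  "push K j b = seq
     (basic K (\<lambda>s k. (s ! k, if k = j then Move_Left else Stay)))
     (basic K (\<lambda>s k. (if k = j then Some b else s ! k, Stay)))"

lemma push_tm [intro!]: "is_tm K (push K j b)"
  unfolding push_def by blast

lemma runs_push: "runs (push K j b) 2 (regs K \<sigma>) (regs K (\<sigma>(j := b # \<sigma> j)))"
proof -
  define \<tau>1 where "\<tau>1 k = (if k = j then update_tape (string_tape (\<sigma> k) 0, Move_Left) (string_tape (\<sigma> k))
    else string_tape (\<sigma> k))" for k
  have "runs (push K j b) (1 + 1) (regs K \<sigma>) (regs K (\<sigma>(j := b # \<sigma> j)))"
    unfolding push_def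
  proof (rule runs_seq[OF basic_tm basic_tm])
    show "runs (basic K (\<lambda>s k. (s ! k, if k = j then Move_Left else Stay))) 1 (regs K \<sigma>) (tapes K \<tau>1)"
      by (rule runs_basic) (simp add: \<tau>1_def del: update_tape.simps)
    show "runs (basic K (\<lambda>s k. (if k = j then Some b else s ! k, Stay))) 1 (tapes K \<tau>1) (regs K (\<sigma>(j := b # \<sigma> j)))"
      by (rule runs_basic) (simp add: \<tau>1_def push_string_tape del: update_tape.simps)
  qed simp
  then show ?thesis by (simp add: numeral_2_eq_2)
qed

lemma runs_push_strs:
  assumes "length zs = K" "j < K"
  shows "runs (push K j b) 2 (strs zs) (strs (zs[j := b # zs ! j]))"
proof -
  have "regs K ((nth zs)(j := b # zs ! j)) = strs (zs[j := b # zs ! j])"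
    using assms by (intro nth_equalityI) auto
  then show ?thesis using runs_push[of K j b "nth zs"] by (simp add: regs_nth[OF assms(1)])
qed

subsection \<open>Primitive functions\<close>

text \<open>Lengths act as unary numbers: both stacks are popped together until the second is empty.
  Popping an exhausted first stack is harmless, just as \<open>drop\<close> is beyond the
  end.\<close>

lemma polytime_drop: "polytime 2 (\<lambda>xs. drop (length (xs ! 1)) (xs ! 0))"
proof -
  define M where "M = loop (\<lambda>s. s ! 1 \<noteq> None) (basic 2 (\<lambda>s k. (None, Move_Right)))"
  have run: "runs M (2 * length a + 1) (strs [b, a]) (strs [drop (length a) b, []])" for a b
  proof (induction a arbitrary: b)
    case Nil
    have "runs M 1 (strs [b, []]) (strs [b, []])"
      unfolding M_def by (rule runs_loop_done) (simp add: string_tape_0)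
    then show ?case by simp
  next
    case (Cons c a)
    have "runs (basic 2 (\<lambda>s k. (None, Move_Right))) 1 (strs [b, c # a]) (strs [tl b, a])"
      by (rule runs_basic_strs)
        (auto simp: numeral_eq_Suc less_Suc_eq pop_string_tape simp del: update_tape.simps)
    from runs_loop_step[OF basic_tm _ _ this Cons.IH[of "tl b", unfolded M_def]]
    show ?case unfolding M_def by (simp add: string_tape_0 drop_Suc)
  qed
  show ?thesis
  proof (rule polytimeI_strs[of 2 M 2 "\<lambda>n. 2 * n + 1"])
    show "is_tm 2 M" unfolding M_def by blast
    show "polynomial_fun (\<lambda>n. 2 * n + 1)" by (intro polynomial_fun_add polynomial_fun_mult polynomial_fun_const polynomial_fun_id)
    fix xs :: "bool list list"
    assume "length xs = 2"
    then obtain b a where xs: "xs = [b, a]" by (auto simp: numeral_eq_Suc length_Suc_conv)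
    show "\<exists>zs. length zs = 2 \<and> zs ! 0 = drop (length (xs ! 1)) (xs ! 0) \<and>
      runs M (2 * total_length xs + 1) (strs (xs @ replicate (2 - 2) [])) (strs zs)"
      using runs_mono[OF run[of a b], of "2 * total_length xs + 1"]
      by (intro exI[of _ "[drop (length a) b, []]"]) (simp add: xs)
  qed simp_all
qed

text \<open>Symbols pile up in reverse on the third tape while the second counts down; the rest of
  the first is erased and the pile poured back. The second tape may retain a rest
  \<open>a'\<close>.\<close>

lemma polytime_take: "polytime 2 (\<lambda>xs. take (length (xs ! 1)) (xs ! 0))"
proof -
  define B where "B = seq (transfer 3 0 {2}) (basic 3 (\<lambda>s k. if k = 1 then (None, Move_Right) else (s ! k, Stay)))"
  define M where "M = loop (\<lambda>s. s ! 0 \<noteq> None \<and> s ! 1 \<noteq> None) B"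
  define N where "N = seq M (seq (pour 3 0 {}) (pour 3 2 {0}))"
  have B: "is_tm 3 B" unfolding B_def by blast
  have run: "\<exists>b' a'. length b' \<le> length b \<and>
    runs M (4 * length a + 1) (strs [b, a, c]) (strs [b', a', rev (take (length a) b) @ c])" for a b c
  proof (induction a arbitrary: b c)
    case Nil
    have "runs M 1 (strs [b, [], c]) (strs [b, [], c])"
      unfolding M_def by (intro runs_loop_done) (simp add: string_tape_0)
    then show ?case by auto
  next
    case (Cons y a)
    show ?case
    proof (cases b)
      case Nil
      have "runs M 1 (strs [b, y # a, c]) (strs [b, y # a, c])"
        unfolding M_def using Nil by (intro runs_loop_done) (simp add: string_tape_0)
      then have "runs M (4 * length (y # a) + 1) (strs [b, y # a, c]) (strs [b, y # a, c])"
        by (rule runs_mono) simp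
      then show ?thesis using Nil by auto
    next
      case (Cons x z)
      obtain b' a' where IH: "length b' \<le> length z"
        "runs M (4 * length a + 1) (strs [z, a, x # c]) (strs [b', a', rev (take (length a) z) @ x # c])"
        using Cons.IH by blast
      have r1: "runs (transfer 3 0 {2}) 2 (strs [x # z, y # a, c]) (strs [z, y # a, x # c])"
        by (rule runs_transfer_strs[of 0 3 _ _ x z]) (simp_all add: numeral_eq_Suc)
      have r2: "runs (basic 3 (\<lambda>s k. if k = 1 then (None, Move_Right) else (s ! k, Stay))) 1
          (strs [z, y # a, x # c]) (strs [z, a, x # c])"
        by (rule runs_basic_strs)
          (auto simp: numeral_eq_Suc less_Suc_eq pop_string_tape simp del: update_tape.simps)
      have rB: "runs B (2 + 1) (strs [x # z, y # a, c]) (strs [z, a, x # c])"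
        unfolding B_def by (rule runs_seq[OF transfer_tm basic_tm _ r1 r2]) simp
      have "runs M (Suc (2 + 1 + (4 * length a + 1))) (strs [x # z, y # a, c])
          (strs [b', a', rev (take (length a) z) @ x # c])"
        unfolding M_def by (rule runs_loop_step[OF B _ _ rB IH(2)[unfolded M_def]]) (simp_all add: string_tape_0)
      then show ?thesis using IH(1) Cons by (intro exI[of _ b'] exI[of _ a']) (simp add: eval_nat_numeral)
    qed
  qed
  show ?thesis
  proof (rule polytimeI_strs[of 3 N 2 "\<lambda>n. 10 * n + 3"])
    have M: "is_tm 3 M" unfolding M_def using B by blast
    then show "is_tm 3 N" unfolding N_def by blast
    show "polynomial_fun (\<lambda>n. 10 * n + 3)" by (intro polynomial_fun_add polynomial_fun_mult polynomial_fun_const polynomial_fun_id)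
    fix xs :: "bool list list"
    assume "length xs = 2"
    then obtain b a where xs: "xs = [b, a]" by (auto simp: numeral_eq_Suc length_Suc_conv)
    define w where "w = take (length a) b"
    obtain b' a' where r: "length b' \<le> length b"
      "runs M (4 * length a + 1) (strs [b, a, []]) (strs [b', a', rev w])"
      using run[of b a "[]"] unfolding w_def by auto
    have r2: "runs (pour 3 0 {}) (3 * length ([b', a', rev w] ! 0) + 1) (strs [b', a', rev w]) (strs [[], a', rev w])"
      by (rule runs_pour_strs) (simp_all add: numeral_eq_Suc)
    have r3: "runs (pour 3 2 {0}) (3 * length ([[], a', rev w] ! 2) + 1) (strs [[], a', rev w]) (strs [w, a', []])"
      by (rule runs_pour_strs) (simp_all add: numeral_eq_Suc)
    have "runs (seq (pour 3 0 {}) (pour 3 2 {0})) ((3 * length b' + 1) + (3 * length w + 1))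
      (strs [b', a', rev w]) (strs [w, a', []])"
      using runs_seq[OF pour_tm pour_tm _ r2 r3] by simp
    then have "runs N ((4 * length a + 1) + ((3 * length b' + 1) + (3 * length w + 1)))
      (strs [b, a, []]) (strs [w, a', []])"
      unfolding N_def by (intro runs_seq[OF M _ _ r(2)]) auto
    then have "runs N (10 * total_length xs + 3) (strs [b, a, []]) (strs [w, a', []])"
      by (rule runs_mono) (use r(1) in \<open>simp add: xs w_def\<close>)
    then show "\<exists>zs. length zs = 3 \<and> zs ! 0 = take (length (xs ! 1)) (xs ! 0) \<and>
      runs N (10 * total_length xs + 3) (strs (xs @ replicate (3 - 2) [])) (strs zs)"
      by (intro exI[of _ "[w, a', []]"]) (simp add: xs w_def)
  qed simp_all
qed

text \<open>A fallback: a nonempty verdict is kept, an undecided one is replaced by the first bit of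
  the second string. A blank reads as \<open>False\<close>.\<close>

lemma polytime_or_else: "polytime 2 (\<lambda>xs. if xs ! 0 = [] then [xs ! 1 \<noteq> [] \<and> hd (xs ! 1)] else xs ! 0)"
proof (rule polytimeI_strs)
  define f where "f s k = (if k = 0 \<and> s ! 0 = None then Some (s ! 1 = Some True) else s ! k, Stay)"
    for s :: "symbol list" and k
  show "is_tm 2 (basic 2 f)" by blast
  fix xs :: "bool list list"
  assume "length xs = 2"
  then obtain a b where xs: "xs = [a, b]" by (auto simp: numeral_eq_Suc length_Suc_conv)
  have "runs (basic 2 f) 1 (strs [a, b]) (strs [if a = [] then [b \<noteq> [] \<and> hd b] else a, b])"
    by (rule runs_basic_strs)
      (auto simp: f_def numeral_eq_Suc less_Suc_eq string_tape_0 set_string_tape blank_string_tape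
        simp del: update_tape.simps split: list.split)
  then show "\<exists>zs. length zs = 2 \<and> zs ! 0 = (if xs ! 0 = [] then [xs ! 1 \<noteq> [] \<and> hd (xs ! 1)] else xs ! 0) \<and>
      runs (basic 2 f) 1 (strs (xs @ replicate (2 - 2) [])) (strs zs)"
    by (intro exI[of _ "[if a = [] then [b \<noteq> [] \<and> hd b] else a, b]"]) (simp add: xs)
qed auto

text \<open>With \<^const>\<open>int_bits\<close> in mind, \<open>xs ! 0\<close> is a sign bit or empty, for \<open>\<plusminus>2 ^ length (xs ! 1)\<close> or \<open>0\<close>.\<close>

lemma polytime_power:
  "polytime 2 (\<lambda>xs. if xs ! 0 = [] then [False] else hd (xs ! 0) # replicate (length (xs ! 1)) False @ [True])"
proof -
  \<comment> \<open>Tape 2 saves the sign while tape 0 is rebuilt from its far end: leading one,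
    zeros, sign. Without a sign the loop does not start and the \<open>False\<close> pushed last is
    the whole result; otherwise \<open>f4\<close> overwrites it by the sign.\<close>
  define f1 where "f1 s k = (if k = 2 then s ! 0 else s ! k, Stay)" for s :: "symbol list" and k :: nat
  define f2 where "f2 s k = (if k = 0 \<and> s ! 2 \<noteq> None then Some True else s ! k, Stay)" for s :: "symbol list" and k :: nat
  define f3 where "f3 s k = (if k = 1 then (None, Move_Right) else (s ! k, Stay))" for s :: "symbol list" and k :: nat
  define f4 where "f4 s k = (if k = 0 \<and> s ! 2 \<noteq> None then s ! 2 else s ! k, Stay)" for s :: "symbol list" and k :: nat
  define B where "B = seq (push 3 0 False) (basic 3 f3)"
  define M where "M = loop (\<lambda>s. s ! 1 \<noteq> None \<and> s ! 2 \<noteq> None) B"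
  define N where "N = seq (basic 3 f1) (seq (pour 3 0 {}) (seq (basic 3 f2) (seq M (seq (push 3 0 False) (basic 3 f4)))))"
  have B: "is_tm 3 B" unfolding B_def by blast
  then have M: "is_tm 3 M" unfolding M_def by blast
  have loop1: "runs M (4 * length b + 1) (strs [c, b, []]) (strs [c, b, []])" for b c
  proof -
    have "runs M 1 (strs [c, b, []]) (strs [c, b, []])"
      unfolding M_def by (rule runs_loop_done) (simp add: string_tape_0)
    then show ?thesis by (rule runs_mono) simp
  qed
  have loop2: "runs M (4 * length b + 1) (strs [c, b, [x]]) (strs [replicate (length b) False @ c, [], [x]])" for b c x
  proof (induction b arbitrary: c)
    case Nil
    have "runs M 1 (strs [c, [], [x]]) (strs [c, [], [x]])"
      unfolding M_def by (rule runs_loop_done) (simp add: string_tape_0)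
    then show ?case by simp
  next
    case (Cons y b)
    have r1: "runs (push 3 0 False) 2 (strs [c, y # b, [x]]) (strs [False # c, y # b, [x]])"
      using runs_push_strs[of "[c, y # b, [x]]" 3 0 False] by simp
    have r2: "runs (basic 3 f3) 1 (strs [False # c, y # b, [x]]) (strs [False # c, b, [x]])"
      by (rule runs_basic_strs)
        (auto simp: f3_def numeral_eq_Suc less_Suc_eq pop_string_tape simp del: update_tape.simps)
    have rB: "runs B (2 + 1) (strs [c, y # b, [x]]) (strs [False # c, b, [x]])"
      unfolding B_def by (rule runs_seq[OF push_tm basic_tm _ r1 r2]) simp
    have "runs M (Suc (2 + 1 + (4 * length b + 1))) (strs [c, y # b, [x]])
      (strs [replicate (length b) False @ False # c, [], [x]])"
      unfolding M_def
      by (rule runs_loop_step[OF B _ _ rB Cons.IH[unfolded M_def]]) (simp_all add: string_tape_0)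
    then show ?case by (simp add: eval_nat_numeral replicate_app_Cons_same)
  qed
  show ?thesis
  proof (rule polytimeI_strs[of 3 N 2 "\<lambda>n. 10 * n + 7"])
    show "is_tm 3 N" unfolding N_def using M by blast
    show "polynomial_fun (\<lambda>n. 10 * n + 7)" by (intro polynomial_fun_add polynomial_fun_mult polynomial_fun_const polynomial_fun_id)
    fix xs :: "bool list list"
    assume "length xs = 2"
    then obtain s b where xs: "xs = [s, b]" by (auto simp: numeral_eq_Suc length_Suc_conv)
    define c where "c = (if s = [] then [] else [hd s])"
    define e where "e = (if s = [] then [] else [True])"
    define b' where "b' = (if s = [] then b else [])"
    define d where "d = (if s = [] then [] else replicate (length b) False @ [True])"
    define r where "r = (if s = [] then [False] else hd s # replicate (length b) False @ [True])"
    have r1: "runs (basic 3 f1) 1 (strs [s, b, []]) (strs [s, b, c])"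
      by (rule runs_basic_strs)
        (auto simp: c_def f1_def numeral_eq_Suc less_Suc_eq string_tape_0 set_string_tape blank_string_tape
          simp del: update_tape.simps split: list.split)
    have r2: "runs (pour 3 0 {}) (3 * length ([s, b, c] ! 0) + 1) (strs [s, b, c]) (strs [[], b, c])"
      by (rule runs_pour_strs) (simp_all add: numeral_eq_Suc)
    have r3: "runs (basic 3 f2) 1 (strs [[], b, c]) (strs [e, b, c])"
      by (rule runs_basic_strs)
        (auto simp: c_def e_def f2_def numeral_eq_Suc less_Suc_eq string_tape_0 set_string_tape blank_string_tape
          simp del: update_tape.simps split: list.split)
    have r4: "runs M (4 * length b + 1) (strs [e, b, c]) (strs [d, b', c])"
      using loop1[of b "[]"] loop2[of b "[True]" "hd s"] by (cases s) (simp_all add: e_def d_def b'_def c_def)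
    have r5: "runs (push 3 0 False) 2 (strs [d, b', c]) (strs [False # d, b', c])"
      using runs_push_strs[of "[d, b', c]" 3 0 False] by simp
    have r6: "runs (basic 3 f4) 1 (strs [False # d, b', c]) (strs [r, b', c])"
      by (rule runs_basic_strs)
        (auto simp: c_def r_def d_def f4_def numeral_eq_Suc less_Suc_eq string_tape_0 set_string_tape
          blank_string_tape simp del: update_tape.simps split: list.split)
    have "runs N (1 + (3 * length ([s, b, c] ! 0) + 1 + (1 + (4 * length b + 1 + (2 + 1))))) (strs [s, b, []]) (strs [r, b', c])"
      unfolding N_def using M by (intro runs_seq[where K = 3, OF _ _ _ r1] runs_seq[where K = 3, OF _ _ _ r2]
        runs_seq[where K = 3, OF _ _ _ r3] runs_seq[where K = 3, OF _ _ _ r4] runs_seq[where K = 3, OF _ _ _ r5 r6]) auto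
    then have "runs N (10 * total_length xs + 7) (strs [s, b, []]) (strs [r, b', c])"
      by (rule runs_mono) (simp add: xs)
    then show "\<exists>zs. length zs = 3 \<and> zs ! 0 = (if xs ! 0 = [] then [False] else hd (xs ! 0) # replicate (length (xs ! 1)) False @ [True]) \<and>
      runs N (10 * total_length xs + 7) (strs (xs @ replicate (3 - 2) [])) (strs zs)"
      by (intro exI[of _ "[r, b', c]"]) (simp add: xs r_def)
  qed simp_all
qed

abbreviation bits_value :: "bool list \<Rightarrow> nat" where
  "bits_value bs \<equiv> horner_sum of_bool 2 bs"

text \<open>The comparison runs from the least significant bit on; a flag records how the bits read so far
  compare. Reading \<open>4 * bits_value y + 2\<close> amounts to two additional leading bits.\<close>

lemma polytime_compare:
  "polytime 2 (\<lambda>xs. if 4 * bits_value (xs ! 1) + 2 < bits_value (tl (xs ! 0)) then take 1 (xs ! 0) else [])"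
proof -
  \<comment> \<open>Tape 2 carries the flag, tape 3 the sign of the first argument.\<close>
  define f1 where "f1 s k = (if k = 0 then (None, Move_Right) else
    (if k = 2 then Some False else if k = 3 then s ! 0 else s ! k, Stay))" for s :: "symbol list" and k :: nat
  define f2 where "f2 s k = (if k = 0 \<or> k = 1 then (None, Move_Right) else
    (if k = 2 then Some (if (s ! 0 = Some True) = (s ! 1 = Some True) then s ! 2 = Some True else s ! 0 = Some True)
     else s ! k, Stay))" for s :: "symbol list" and k :: nat
  define f3 where "f3 s k = (if k = 0 \<and> s ! 2 = Some True then s ! 3 else s ! k, Stay)" for s :: "symbol list" and k :: nat
  define M where "M = loop (\<lambda>s. s ! 0 \<noteq> None \<or> s ! 1 \<noteq> None) (basic 4 f2)"
  define N where "N = seq (basic 4 f1) (seq (push 4 1 True) (seq (push 4 1 False) (seq M (basic 4 f3))))"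
  have M: "is_tm 4 M" unfolding M_def by blast
  have run: "runs M (2 * (length s + length y) + 1) (strs [s, y, [b], c])
    (strs [[], [], [if bits_value y = bits_value s then b else bits_value y < bits_value s], c])" for s y b c
  proof (induction "length s + length y" arbitrary: s y b rule: less_induct)
    case less
    show ?case
    proof (cases "s = [] \<and> y = []")
      case True
      have "runs M 1 (strs [[], [], [b], c]) (strs [[], [], [b], c])"
        unfolding M_def by (rule runs_loop_done) (simp add: string_tape_0)
      then show ?thesis using True by simp
    next
      case False
      define b' where "b' = (if (s \<noteq> [] \<and> hd s) = (y \<noteq> [] \<and> hd y) then b else s \<noteq> [] \<and> hd s)"
      have r: "runs (basic 4 f2) 1 (strs [s, y, [b], c]) (strs [tl s, tl y, [b'], c])"
        by (rule runs_basic_strs)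
          (auto simp: b'_def f2_def numeral_eq_Suc less_Suc_eq string_tape_0 pop_string_tape set_string_tape
            blank_string_tape simp del: update_tape.simps split: list.split)
      have IH: "runs M (2 * (length (tl s) + length (tl y)) + 1) (strs [tl s, tl y, [b'], c])
        (strs [[], [], [if bits_value (tl y) = bits_value (tl s) then b' else bits_value (tl y) < bits_value (tl s)], c])"
        using False by (intro less.hyps) (cases s; cases y; simp)
      \<comment> \<open>An exhausted string goes on with zeros, so different lengths need no
        padding.\<close>
      have val: "bits_value z = of_bool (z \<noteq> [] \<and> hd z) + 2 * bits_value (tl z)" for z
        by (cases z) simp_all
      have eq: "(if bits_value (tl y) = bits_value (tl s) then b' else bits_value (tl y) < bits_value (tl s)) =
        (if bits_value y = bits_value s then b else bits_value y < bits_value s)"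
      proof -
        \<comment> \<open>Higher bits overrule lower ones: the current bits \<open>p\<close>,
          \<open>q\<close>, and after them the old flag \<open>b\<close>, count only if the
          remaining numbers agree.\<close>
        have "(if B = A then (if p = q then b else p) else B < A) =
          (if of_bool q + 2 * B = of_bool p + 2 * A then b else of_bool q + 2 * B < of_bool p + 2 * A)"
          for A B :: nat and p q
          by (cases p; cases q; cases A B rule: linorder_cases) auto
        then show ?thesis unfolding b'_def val[of s] val[of y] .
      qed
      have "runs M (Suc (1 + (2 * (length (tl s) + length (tl y)) + 1))) (strs [s, y, [b], c])
        (strs [[], [], [if bits_value y = bits_value s then b else bits_value y < bits_value s], c])"
        unfolding M_def
      proof (rule runs_loop_step[OF basic_tm _ _ r])
        show "map (\<lambda>t. t 0) (strs [s, y, [b], c]) ! 0 \<noteq> None \<or> map (\<lambda>t. t 0) (strs [s, y, [b], c]) ! 1 \<noteq> None"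
          using False by (auto simp: string_tape_0 split: list.split)
        show "runs (loop (\<lambda>s. s ! 0 \<noteq> None \<or> s ! 1 \<noteq> None) (basic 4 f2)) (2 * (length (tl s) + length (tl y)) + 1)
          (strs [tl s, tl y, [b'], c])
          (strs [[], [], [if bits_value y = bits_value s then b else bits_value y < bits_value s], c])"
          using IH unfolding eq M_def .
      qed simp
      then show ?thesis by (rule runs_mono) (use False in \<open>cases s; cases y; simp\<close>)
    qed
  qed
  show ?thesis
  proof (rule polytimeI_strs[of 4 N 2 "\<lambda>n. 2 * n + 15"])
    show "is_tm 4 N" unfolding N_def using M by blast
    show "polynomial_fun (\<lambda>n. 2 * n + 15)" by (intro polynomial_fun_add polynomial_fun_mult polynomial_fun_const polynomial_fun_id)
    fix xs :: "bool list list"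
    assume "length xs = 2"
    then obtain s y where xs: "xs = [s, y]" by (auto simp: numeral_eq_Suc length_Suc_conv)
    define y' where "y' = False # True # y"
    define lt where "lt \<longleftrightarrow> bits_value y' < bits_value (tl s)"
    define c where "c = (if s = [] then [] else [hd s])"
    define r where "r = (if lt then c else [])"
    have r1: "runs (basic 4 f1) 1 (strs [s, y, [], []]) (strs [tl s, y, [False], c])"
      by (rule runs_basic_strs)
        (auto simp: c_def f1_def numeral_eq_Suc less_Suc_eq string_tape_0 pop_string_tape set_string_tape
            blank_string_tape simp del: update_tape.simps split: list.split)
    have r2: "runs (push 4 1 True) 2 (strs [tl s, y, [False], c]) (strs [tl s, True # y, [False], c])"
      using runs_push_strs[of "[tl s, y, [False], c]" 4 1 True] by simp
    have r3: "runs (push 4 1 False) 2 (strs [tl s, True # y, [False], c]) (strs [tl s, y', [False], c])"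
      using runs_push_strs[of "[tl s, True # y, [False], c]" 4 1 False] by (simp add: y'_def)
    \<comment> \<open>The initial flag \<open>False\<close> makes the comparison strict.\<close>
    have "(if bits_value y' = bits_value (tl s) then False else bits_value y' < bits_value (tl s)) = lt"
      by (auto simp: lt_def)
    then have r4: "runs M (2 * (length (tl s) + length y') + 1) (strs [tl s, y', [False], c]) (strs [[], [], [lt], c])"
      using run[of "tl s" y' False c] by simp
    have r5: "runs (basic 4 f3) 1 (strs [[], [], [lt], c]) (strs [r, [], [lt], c])"
      by (rule runs_basic_strs)
        (auto simp: r_def c_def f3_def numeral_eq_Suc less_Suc_eq string_tape_0 set_string_tape
            blank_string_tape simp del: update_tape.simps split: list.split)
    have "runs N (1 + (2 + (2 + (2 * (length (tl s) + length y') + 1 + 1)))) (strs [s, y, [], []]) (strs [r, [], [lt], c])"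
      unfolding N_def using M by (intro runs_seq[where K = 4, OF _ _ _ r1] runs_seq[where K = 4, OF _ _ _ r2]
        runs_seq[where K = 4, OF _ _ _ r3] runs_seq[where K = 4, OF _ _ _ r4 r5]) auto
    then have rN: "runs N (2 * total_length xs + 15) (strs [s, y, [], []]) (strs [r, [], [lt], c])"
      by (rule runs_mono) (simp add: xs y'_def)
    have "lt \<longleftrightarrow> 4 * bits_value y + 2 < bits_value (tl s)" by (simp add: lt_def y'_def)
    moreover have "c = take 1 s" by (cases s) (simp_all add: c_def)
    ultimately have r: "r = (if 4 * bits_value (xs ! 1) + 2 < bits_value (tl (xs ! 0)) then take 1 (xs ! 0) else [])"
      unfolding r_def xs by simp
    have "xs @ replicate (4 - 2) [] = [s, y, [], []]" by (simp add: xs numeral_2_eq_2)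
    then show "\<exists>zs. length zs = 4 \<and>
      zs ! 0 = (if 4 * bits_value (xs ! 1) + 2 < bits_value (tl (xs ! 0)) then take 1 (xs ! 0) else []) \<and>
      runs N (2 * total_length xs + 15) (strs (xs @ replicate (4 - 2) [])) (strs zs)"
      using rN unfolding r[symmetric] by (intro exI[of _ "[r, [], [lt], c]"]) simp
  qed simp_all
qed

section \<open>Unary evaluation of Newton forms by difference schemes\<close>

primrec pushes :: "nat \<Rightarrow> bool \<Rightarrow> nat \<Rightarrow> nat \<Rightarrow> turing_machine" where
  "pushes K a j 0 = noop K"
| "pushes K a j (Suc c) = seq (push K j a) (pushes K a j c)"

lemma pushes_tm [intro!]: "is_tm K (pushes K a j c)"
  by (induction c) auto

lemma runs_pushes:
  "runs (pushes K a j c) (2 * c) (regs K \<sigma>) (regs K (\<sigma>(j := replicate c a @ \<sigma> j)))"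
proof (induction c arbitrary: \<sigma>)
  case 0
  have "\<sigma>(j := replicate 0 a @ \<sigma> j) = \<sigma>" by simp
  then show ?case by (simp add: runs_noop del: fun_upd_apply)
next
  case (Suc c)
  have "(\<sigma>(j := a # \<sigma> j))(j := replicate c a @ (\<sigma>(j := a # \<sigma> j)) j) = \<sigma>(j := replicate (Suc c) a @ \<sigma> j)"
    by (simp add: replicate_app_Cons_same)
  moreover have "runs (pushes K a j (Suc c)) (2 + 2 * c) (regs K \<sigma>)
    (regs K ((\<sigma>(j := a # \<sigma> j))(j := replicate c a @ (\<sigma>(j := a # \<sigma> j)) j)))"
    unfolding pushes.simps by (rule runs_seq[OF push_tm pushes_tm _ runs_push Suc.IH]) simp
  ultimately show ?case by (simp del: fun_upd_apply pushes.simps)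
qed

fun fill :: "nat \<Rightarrow> bool \<Rightarrow> nat \<Rightarrow> nat list \<Rightarrow> turing_machine" where
  "fill K a j [] = noop K"
| "fill K a j (c # cs) = seq (pushes K a j c) (fill K a (Suc j) cs)"

lemma fill_tm [intro!]: "is_tm K (fill K a j cs)"
  by (induction cs arbitrary: j) auto

lemma runs_fill:
  assumes "\<And>k. j \<le> k \<Longrightarrow> \<sigma> k = []"
  shows "runs (fill K a j cs) (2 * sum_list cs) (regs K \<sigma>)
    (regs K (\<lambda>k. if j \<le> k \<and> k < j + length cs then replicate (cs ! (k - j)) a else \<sigma> k))"
  using assms
proof (induction cs arbitrary: j \<sigma>)
  case Nil
  have eq: "(if j \<le> k \<and> k < j + length [] then replicate ([] ! (k - j)) a else \<sigma> k) = \<sigma> k" for k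
    by auto
  show ?case unfolding eq by (simp add: runs_noop)
next
  case (Cons c cs)
  define \<sigma>1 where "\<sigma>1 = \<sigma>(j := replicate c a @ \<sigma> j)"
  have "runs (fill K a (Suc j) cs) (2 * sum_list cs) (regs K \<sigma>1)
    (regs K (\<lambda>k. if Suc j \<le> k \<and> k < Suc j + length cs then replicate (cs ! (k - Suc j)) a else \<sigma>1 k))"
    using Cons.prems by (intro Cons.IH) (simp add: \<sigma>1_def)
  also have "(\<lambda>k. if Suc j \<le> k \<and> k < Suc j + length cs then replicate (cs ! (k - Suc j)) a else \<sigma>1 k) =
    (\<lambda>k. if j \<le> k \<and> k < j + length (c # cs) then replicate ((c # cs) ! (k - j)) a else \<sigma> k)"
    using Cons.prems by (auto simp: \<sigma>1_def fun_eq_iff nth_Cons')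
  finally have r: "runs (fill K a (Suc j) cs) (2 * sum_list cs) (regs K \<sigma>1)
    (regs K (\<lambda>k. if j \<le> k \<and> k < j + length (c # cs) then replicate ((c # cs) ! (k - j)) a else \<sigma> k))" .
  have "runs (fill K a j (c # cs)) (2 * c + 2 * sum_list cs) (regs K \<sigma>)
    (regs K (\<lambda>k. if j \<le> k \<and> k < j + length (c # cs) then replicate ((c # cs) ! (k - j)) a else \<sigma> k))"
    unfolding fill.simps by (rule runs_seq[OF pushes_tm fill_tm _ runs_pushes r[unfolded \<sigma>1_def]]) simp
  then show ?case by (simp add: distrib_left)
qed

text \<open>The order matters: each register receives the next one before that one is updated, so a
  row of the scheme is computed in place.\<close>

fun table_row :: "nat \<Rightarrow> nat \<Rightarrow> nat \<Rightarrow> turing_machine" where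
  "table_row K l 0 = noop K"
| "table_row K l (Suc e) = seq (table_row K l e) (dup K l (e + 2) (e + 1))"

lemma table_row_tm [intro!]: "is_tm K (table_row K l e)"
  by (induction e) auto

text \<open>The unary contents of the registers after \<open>m\<close> rounds of the difference scheme for
  \<^const>\<open>newton\<close>; the register following the last difference stays empty.\<close>

definition table :: "bool \<Rightarrow> nat list \<Rightarrow> nat \<Rightarrow> bool list \<Rightarrow> nat \<Rightarrow> bool list" where
  "table a cs m y k = (if k = 0 then y else if k \<le> Suc (length cs)
     then replicate (newton (drop (k - 1) cs) m) a else [])"

lemma runs_dup_regs:
  assumes "i < K" "l < K" "distinct [i, j, l]" "\<sigma> l = []"
  shows "runs (dup K l i j) (6 * length (\<sigma> i) + 2) (regs K \<sigma>) (regs K (\<sigma>(j := \<sigma> i @ \<sigma> j)))"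
proof -
  have eq: "tapes K ((\<lambda>k. string_tape (\<sigma> k))(j := string_tape (\<sigma> i @ \<sigma> j))) = regs K (\<sigma>(j := \<sigma> i @ \<sigma> j))"
    by auto
  show ?thesis
    unfolding eq[symmetric] by (rule runs_dup) (use assms in simp_all)
qed

lemma runs_table_row:
  assumes "K = length cs + 3" "l = length cs + 2" "e \<le> length cs" "\<And>i. newton (drop i cs) m \<le> B"
  shows "runs (table_row K l e) (e * (6 * B + 2)) (regs K (table a cs m y))
    (regs K (\<lambda>k. table a cs (if k \<le> e then Suc m else m) y k))"
  using assms(3)
proof (induction e)
  case 0
  have eq: "table a cs (if k \<le> 0 then Suc m else m) y k = table a cs m y k" for k
    by (auto simp: table_def)
  show ?case unfolding eq by (simp add: runs_noop)
next
  case (Suc e)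
  define \<sigma> where "\<sigma> k = table a cs (if k \<le> e then Suc m else m) y k" for k
  have r1: "runs (table_row K l e) (e * (6 * B + 2)) (regs K (table a cs m y)) (regs K \<sigma>)"
    using Suc unfolding \<sigma>_def by simp
  have "runs (dup K l (e + 2) (e + 1)) (6 * length (\<sigma> (e + 2)) + 2) (regs K \<sigma>)
    (regs K (\<sigma>(e + 1 := \<sigma> (e + 2) @ \<sigma> (e + 1))))"
    by (rule runs_dup_regs) (use assms Suc.prems in \<open>auto simp: \<sigma>_def table_def\<close>)
  also have "\<sigma>(e + 1 := \<sigma> (e + 2) @ \<sigma> (e + 1)) = (\<lambda>k. table a cs (if k \<le> Suc e then Suc m else m) y k)"
  proof
    fix k
    have new: "newton (drop e cs) (Suc m) = newton (drop (Suc e) cs) m + newton (drop e cs) m"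
      by (simp add: newton_Suc drop_Suc tl_drop)
    consider "k \<le> e" | "k = Suc e" | "Suc e < k" by linarith
    then show "(\<sigma>(e + 1 := \<sigma> (e + 2) @ \<sigma> (e + 1))) k = table a cs (if k \<le> Suc e then Suc m else m) y k"
      using Suc.prems by cases (simp_all add: \<sigma>_def table_def new flip: replicate_add)
  qed
  finally have "runs (dup K l (e + 2) (e + 1)) (6 * length (\<sigma> (e + 2)) + 2) (regs K \<sigma>)
    (regs K (\<lambda>k. table a cs (if k \<le> Suc e then Suc m else m) y k))" .
  moreover have "length (\<sigma> (e + 2)) \<le> B"
    using assms(4) by (simp add: \<sigma>_def table_def)
  ultimately have r2: "runs (dup K l (e + 2) (e + 1)) (6 * B + 2) (regs K \<sigma>)
    (regs K (\<lambda>k. table a cs (if k \<le> Suc e then Suc m else m) y k))"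
    by (elim runs_mono) simp
  have "runs (table_row K l (Suc e)) (e * (6 * B + 2) + (6 * B + 2)) (regs K (table a cs m y))
    (regs K (\<lambda>k. table a cs (if k \<le> Suc e then Suc m else m) y k))"
    unfolding table_row.simps by (rule runs_seq[OF table_row_tm dup_tm _ r1 r2]) simp
  then show ?case by (rule runs_mono) simp
qed

text \<open>Each input symbol triggers one row of the scheme, so the rounds count the length and
  register 1 ends with the desired value.\<close>

lemma polytime_unary:
  "polytime 1 (\<lambda>xs. replicate (newton cs (length (xs ! 0))) a)"
proof -
  define d where "d = length cs"
  \<comment> \<open>Tape 0 is the input, tapes 1 to \<open>d + 1\<close> are the registers, the last
    of them always empty, and tape \<open>d + 2\<close> is scratch. Thus register 1 exists even for
    \<open>cs = []\<close>.\<close>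
  define K where "K = d + 3"
  define l where "l = d + 2"
  \<comment> \<open>By monotonicity this bounds every register in all rounds up to
    \<open>n\<close>.\<close>
  define B where "B n = (\<Sum>i\<le>d. newton (drop i cs) n)" for n
  define f where "f s k = (if k = 0 then (None, Move_Right) else (s ! k, Stay))" for s :: "symbol list" and k :: nat
  define R where "R = seq (basic K f) (table_row K l d)"
  define M where "M = loop (\<lambda>s. s ! 0 \<noteq> None) R"
  define N where "N = seq (fill K a 1 cs) (seq M (dup K l 1 0))"
  have R: "is_tm K R" unfolding R_def by blast
  then have M: "is_tm K M" unfolding M_def by blast
  have B: "newton (drop i cs) m \<le> B n" if "m \<le> n" for i m n
  proof (cases "i \<le> d")
    case True
    then have "newton (drop i cs) n \<le> B n" unfolding B_def by (intro member_le_sum) simp_all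
    then show ?thesis using monoD[OF mono_newton that] le_trans by blast
  qed (simp add: d_def)
  have run: "runs M (length y * (d * (6 * B n + 2) + 2) + 1) (regs K (table a cs m y)) (regs K (table a cs (m + length y) []))"
    if "m + length y \<le> n" for m n y
    using that
  proof (induction y arbitrary: m)
    case Nil
    have "runs M 1 (regs K (table a cs m [])) (regs K (table a cs m []))"
      unfolding M_def by (rule runs_loop_done) (simp add: string_tape_0 K_def table_def)
    then show ?case by simp
  next
    case (Cons b y)
    have r1: "runs (basic K f) 1 (regs K (table a cs m (b # y))) (regs K (table a cs m y))"
      by (rule runs_basic)
        (auto simp: f_def table_def pop_string_tape simp del: update_tape.simps)
    have "runs (table_row K l d) (d * (6 * B n + 2)) (regs K (table a cs m y))
      (regs K (\<lambda>k. table a cs (if k \<le> d then Suc m else m) y k))"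
      by (rule runs_table_row) (use B[of m n] Cons.prems in \<open>simp_all add: K_def l_def d_def\<close>)
    also have "(\<lambda>k. table a cs (if k \<le> d then Suc m else m) y k) = table a cs (Suc m) y"
      by (auto simp: table_def d_def fun_eq_iff)
    finally have r2: "runs (table_row K l d) (d * (6 * B n + 2)) (regs K (table a cs m y)) (regs K (table a cs (Suc m) y))" .
    have r: "runs R (1 + d * (6 * B n + 2)) (regs K (table a cs m (b # y))) (regs K (table a cs (Suc m) y))"
      unfolding R_def by (rule runs_seq[OF basic_tm table_row_tm _ r1 r2]) simp
    have IH: "runs M (length y * (d * (6 * B n + 2) + 2) + 1) (regs K (table a cs (Suc m) y))
      (regs K (table a cs (Suc m + length y) []))"
      using Cons.prems by (intro Cons.IH) simp
    have "runs M (Suc (1 + d * (6 * B n + 2) + (length y * (d * (6 * B n + 2) + 2) + 1)))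
      (regs K (table a cs m (b # y))) (regs K (table a cs (Suc m + length y) []))"
      unfolding M_def
      by (rule runs_loop_step[OF R _ _ r IH[unfolded M_def]]) (simp_all add: string_tape_0 K_def table_def)
    then show ?case by (simp add: algebra_simps)
  qed
  define t where "t n = 2 * sum_list cs + ((n * (d * (6 * B n + 2) + 2) + 1) + (6 * B n + 2))" for n
  have "polynomial_fun B"
  proof -
    have "polynomial_fun (\<lambda>n. \<Sum>i\<le>e. newton (drop i cs) n)" for e
    proof (induction e)
      case (Suc e)
      then show ?case unfolding sum.atMost_Suc by (intro polynomial_fun_add polynomial_fun_newton)
    qed (simp add: polynomial_fun_newton)
    then show ?thesis unfolding B_def[abs_def] .
  qed
  show ?thesis
  proof (rule polytimeI[of K N 1 t])
    show "is_tm K N" unfolding N_def using M by blast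
    show "polynomial_fun t"
      unfolding t_def[abs_def]
      by (intro polynomial_fun_add polynomial_fun_mult polynomial_fun_const polynomial_fun_id \<open>polynomial_fun B\<close>)
    fix xs :: "bool list list"
    assume "length xs = 1"
    then obtain x where xs: "xs = [x]" by (auto simp: length_Suc_conv)
    define n where "n = length x"
    have "runs (fill K a 1 cs) (2 * sum_list cs) (regs K (inits xs))
      (regs K (\<lambda>k. if 1 \<le> k \<and> k < 1 + length cs then replicate (cs ! (k - 1)) a else inits xs k))"
      by (rule runs_fill) (simp add: inits_def xs)
    also have "(\<lambda>k. if 1 \<le> k \<and> k < 1 + length cs then replicate (cs ! (k - 1)) a else inits xs k) = table a cs 0 x"
    proof -
      \<comment> \<open>Before the first round the registers hold the differences at 0, which are
        the coefficients themselves.\<close>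
      have "newton (drop i cs) 0 = cs ! i" if "i < length cs" for i
        using that by (simp flip: Cons_nth_drop_Suc)
      then show ?thesis by (auto simp: table_def inits_def xs fun_eq_iff not_less le_Suc_eq)
    qed
    finally have r1: "runs (fill K a 1 cs) (2 * sum_list cs) (regs K (inits xs)) (regs K (table a cs 0 x))" .
    have r2: "runs M (n * (d * (6 * B n + 2) + 2) + 1) (regs K (table a cs 0 x)) (regs K (table a cs n []))"
      using run[of 0 x n] by (simp add: n_def)
    define \<sigma> where "\<sigma> = (table a cs n [])(0 := table a cs n [] 1 @ table a cs n [] 0)"
    have "runs (dup K l 1 0) (6 * length (table a cs n [] 1) + 2) (regs K (table a cs n [])) (regs K \<sigma>)"
      unfolding \<sigma>_def by (rule runs_dup_regs) (simp_all add: K_def l_def table_def d_def)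
    moreover have "length (table a cs n [] 1) \<le> B n" using B[of n n 0] by (simp add: table_def)
    ultimately have r3: "runs (dup K l 1 0) (6 * B n + 2) (regs K (table a cs n [])) (regs K \<sigma>)"
      by (elim runs_mono) simp
    have "runs N (t n) (regs K (inits xs)) (regs K \<sigma>)"
      unfolding N_def t_def using M
      by (intro runs_seq[where K = K, OF _ _ _ r1] runs_seq[where K = K, OF _ _ _ r2 r3]) auto
    moreover have "\<sigma> 0 = replicate (newton cs n) a" by (simp add: \<sigma>_def table_def)
    ultimately show "\<exists>\<tau>. runs N (t (total_length xs)) (regs K (inits xs)) (tapes K \<tau>) \<and>
      reads_from_head (\<tau> 0) (replicate (newton cs (length (xs ! 0))) a)"
      by (intro exI[of _ "\<lambda>k. string_tape (\<sigma> k)"]) (simp add: xs n_def reads_string_tape)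
  qed (simp_all add: K_def)
qed

subsection \<open>The reductions\<close>

lemma polytime_unary_first:
  assumes "0 < m"
  shows "polytime m (\<lambda>xs. replicate (newton cs (length (xs ! 0))) a)"
  using polytime_comp1[OF polytime_unary[of cs a] polytime_nth[OF assms]] by simp

lemma polytime_const_unary:
  assumes "0 < m"
  shows "polytime m (\<lambda>xs. replicate c a)"
  using polytime_unary_first[OF assms, of "[c]" a] by simp

lemma nat_bits_power: "nat_bits (2 ^ k) = replicate k False @ [True]"
proof (induction k)
  case (Suc k)
  then show ?case by (subst nat_bits.simps) simp
qed (simp add: nat_bits.simps)

lemma bits_value_nat_bits: "bits_value (nat_bits n) = n"
proof (induction n rule: nat_bits.induct)
  case (1 n)
  then show ?case by (subst nat_bits.simps) simp
qed

lemma bits_value_less: "bits_value bs < 2 ^ length bs"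
  by (induction bs) auto

lemma int_bits_power: "\<bar>s\<bar> = 1 \<Longrightarrow> int_bits (s * 2 ^ k) = (s < 0) # replicate k False @ [True]"
  by (auto simp: int_bits_def nat_bits_power nat_power_eq abs_if split: if_splits)

lemma int_bits_0: "int_bits 0 = [False]"
  by (simp add: int_bits_def nat_bits.simps)

lemma int_bits_simps: "int_bits z \<noteq> []" "hd (int_bits z) = (z < 0)" "take (Suc 0) (int_bits z) = [z < 0]"
  "bits_value (tl (int_bits z)) = nat \<bar>z\<bar>"
  by (simp_all add: int_bits_def bits_value_nat_bits)

section \<open>Counting and summing over strings of fixed length\<close>

lemma card_bits_value_less:
  assumes "k \<le> 2 ^ n"
  shows "card {y. length y = n \<and> bits_value y < k} = k"
proof -
  let ?S = "{y :: bool list. length y = n}"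
  have inj: "inj_on bits_value ?S"
  proof (rule inj_onI)
    fix x y :: "bool list"
    show "x \<in> ?S \<Longrightarrow> y \<in> ?S \<Longrightarrow> bits_value x = bits_value y \<Longrightarrow> x = y"
    proof (induction n arbitrary: x y)
      case (Suc n)
      then obtain a x' b y' where xy: "x = a # x'" "y = b # y'" "length x' = n" "length y' = n"
        by (auto simp: length_Suc_conv)
      then have "of_bool a + 2 * bits_value x' = of_bool b + 2 * bits_value y'" using Suc.prems by simp
      then have "a = b" "bits_value x' = bits_value y'" by (cases a; cases b; simp; presburger)+
      then show ?case using Suc.IH[of x' y'] xy by simp
    qed simp
  qed
  have card: "card ?S = 2 ^ n" using card_lists_length_eq[of "UNIV :: bool set" n] by simp
  \<comment> \<open>Surjectivity by counting: the image lies in a set of the same size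
    \<open>2 ^ n\<close>.\<close>
  have "bits_value ` ?S = {..<2 ^ n}"
    using bits_value_less inj card by (intro card_subset_eq) (auto simp: card_image)
  then have "bits_value ` {y. length y = n \<and> bits_value y < k} = {..<k}"
    using assms by (force simp: image_iff set_eq_iff)
  moreover have "inj_on bits_value {y. length y = n \<and> bits_value y < k}"
    by (rule inj_on_subset[OF inj]) blast
  ultimately show ?thesis using card_image by fastforce
qed

lemma sum_lists_Suc:
  fixes F :: "bool list \<Rightarrow> 'a :: comm_monoid_add"
  shows "(\<Sum>u | length u = Suc n. F u) = (\<Sum>u | length u = n. F (True # u) + F (False # u))"
proof -
  have fin: "finite {u :: bool list. length u = n}"
    using finite_lists_length_eq[of "UNIV :: bool set" n] by simp
  have "{u :: bool list. length u = Suc n} = Cons True ` {u. length u = n} \<union> Cons False ` {u. length u = n}"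
    by (auto simp: length_Suc_conv image_iff)
  then show ?thesis
    using fin by (simp add: sum.reindex sum.distrib) (subst sum.union_disjoint; auto simp: sum.reindex)
qed

lemma sum_lists_add:
  fixes F :: "bool list \<Rightarrow> 'a :: comm_monoid_add"
  shows "(\<Sum>u | length u = m + n. F u) = (\<Sum>y | length y = m. \<Sum>u | length u = n. F (y @ u))"
proof (induction m arbitrary: F)
  case (Suc m)
  then show ?case by (simp add: sum_lists_Suc sum.distrib)
qed simp

lemma card_lists_bool: "card {u :: bool list. length u = n} = 2 ^ n"
  using card_lists_length_eq[of "UNIV :: bool set" n] by simp

section \<open>Powers of 2 as coefficients of affine reductions\<close>

lemma polytime_int_fun_power:
  assumes "\<bar>s\<bar> = 1"
  shows "polytime_int_fun (\<lambda>x. s * 2 ^ newton cs (length x))"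
  unfolding polytime_int_fun_def polytime_string_fun_def
  using polytime_comp2[OF polytime_power polytime_const_unary[of 1 1 "s < 0"] polytime_unary_first[of 1 cs True]]
  by (simp add: int_bits_power[OF assms])

lemma polytime_rat_fun_power:
  assumes "\<bar>s\<bar> = 1"
  shows "polytime_rat_fun (\<lambda>x. of_int s * 2 ^ newton cs (length x) / 2 ^ newton ds (length x))"
  unfolding polytime_rat_fun_def
  using polytime_int_fun_power[OF assms, of cs] polytime_int_fun_power[of 1 ds]
  by (intro exI[of _ "\<lambda>x. s * 2 ^ newton cs (length x)"] exI[of _ "\<lambda>x. 1 * 2 ^ newton ds (length x)"]) simp

lemma polytime_string_fun_id: "polytime_string_fun (\<lambda>x. x)"
  unfolding polytime_string_fun_def by (rule polytime_nth) simp

text \<open>Here a bound for \<open>p\<close> is not enough; its exact value enters. Since fractions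
  need not be reduced, the subtracted Newton form can go into the denominator.\<close>

lemma polytime_rat_fun_power_polynomial:
  assumes "polynomial_fun p"
  shows "polytime_rat_fun (\<lambda>x. 2 ^ p (length x))" "polytime_rat_fun (\<lambda>x. 2 ^ p (length x) / 2)"
proof -
  obtain cs ds where p: "p n + newton ds n = newton cs n" for n
    using polynomial_fun_newton_diff[OF assms] by blast
  then have pow: "(2::rat) ^ newton cs n = 2 ^ p n * 2 ^ newton ds n" for n
    by (metis power_add)
  show "polytime_rat_fun (\<lambda>x. 2 ^ p (length x))"
    using polytime_rat_fun_power[of 1 cs ds] by (simp add: pow)
  obtain ds' where "newton ds' n = Suc (newton ds n)" for n using newton_Suc_const by blast
  then show "polytime_rat_fun (\<lambda>x. 2 ^ p (length x) / 2)"
    using polytime_rat_fun_power[of 1 cs ds'] by (simp add: pow)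
qed

text \<open>With precision \<open>b = 2\<close>, the weight is 0 iff \<open>\<bar>v x u 2\<bar> \<le> 2\<close>. In that case exactly one value of the
  additional bit is accepted; otherwise both or none are, according to the sign.\<close>

lemma weighted_reduces_to_sharpP:
  assumes "f \<in> sharpP_weighted {-1, 0, 1}"
  shows "\<exists>g\<in>sharpP. affinely_reduces f g"
proof -
  obtain p w v where f: "f = counting_function p w" and p: "polynomial_fun p"
    and v: "polytime_approx v" "\<And>x u b. \<bar>w x u - real_of_int (v x u b) / 2 ^ b\<bar> \<le> 1 / 2 ^ b"
    and w: "\<And>x u. w x u \<in> {-1, 0, 1}"
    using assms unfolding sharpP_weighted_def weighted_counting_problem_def by blast
  define T where "T x u \<longleftrightarrow> (if 2 < \<bar>v x (drop 1 u) 2\<bar> then v x (drop 1 u) 2 < 0 else u \<noteq> [] \<and> hd u)" for x u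
  have V: "polytime 3 (\<lambda>xs. int_bits (v (xs ! 0) (xs ! 1) (length (xs ! 2))))"
    using v(1) unfolding polytime_approx_def .
  have "polytime 2 (\<lambda>xs. drop (length [True]) (xs ! 1))"
    using polytime_comp2[OF polytime_drop polytime_nth[of 1 2] polytime_const_unary[of 2 1 True]] by simp
  from polytime_comp3[OF V polytime_nth[of 0 2] this polytime_const_unary[of 2 2 True]]
  have "polytime 2 (\<lambda>xs. int_bits (v (xs ! 0) (drop 1 (xs ! 1)) 2))" by (simp add: numeral_2_eq_2)
  moreover have "polytime 2 (\<lambda>xs. [])" using polytime_const_unary[of 2 0 True] by simp
  \<comment> \<open>Comparing with the empty string gives the threshold \<open>4 * 0 + 2\<close>;
    the verdict is the sign bit, or empty for weight 0.\<close>
  ultimately have "polytime 2 (\<lambda>xs. if 2 < nat \<bar>v (xs ! 0) (drop 1 (xs ! 1)) 2\<bar> then [v (xs ! 0) (drop 1 (xs ! 1)) 2 < 0] else [])"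
    by (rule polytime_cong[OF polytime_comp2[OF polytime_compare]]) (simp add: int_bits_simps)
  moreover have "polytime 2 (\<lambda>xs. xs ! 1)" by (rule polytime_nth) simp
  ultimately have "polytime 2 (\<lambda>xs. [T (xs ! 0) (xs ! 1)])"
    by (rule polytime_cong[OF polytime_comp2[OF polytime_or_else]]) (auto simp: T_def)
  then have "polytime_predicate T"
    unfolding polytime_predicate_def .
  moreover have "polynomial_fun (\<lambda>n. p n + 1)"
    by (intro polynomial_fun_add polynomial_fun_const p)
  ultimately have g: "counting_function (\<lambda>n. p n + 1) (\<lambda>x u. of_bool (T x u)) \<in> sharpP"
    unfolding sharpP_def by blast
  \<comment> \<open>As \<open>|4 * w - v| \<le> 1\<close>, the weights -1, 0, 1 put \<open>v\<close>
    between -5 and -3, -1 and 1, 3 and 5, which gives 2, 1 and 0 accepted bits.\<close>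
  have "of_bool (T x (True # u)) + of_bool (T x (False # u)) = 1 - w x u" for x u
    using v(2)[of x u 2] w[of x u] by (auto simp: T_def abs_le_iff)
  then have "f x = of_rat (-1) * counting_function (\<lambda>n. p n + 1) (\<lambda>x u. of_bool (T x u)) x + of_rat (2 ^ p (length x))" for x
    by (simp add: f counting_function_def sum_lists_Suc sum_subtractf card_lists_bool of_rat_power)
  \<comment> \<open>The coefficient -1 is \<open>- 2 ^ 0 / 2 ^ 0\<close>, where \<open>[]\<close> is
    the Newton form of 0.\<close>
  then have "affinely_reduces f (counting_function (\<lambda>n. p n + 1) (\<lambda>x u. of_bool (T x u)))"
    unfolding affinely_reduces_def
    using polytime_rat_fun_power[of "-1" "[]" "[]"] polytime_rat_fun_power_polynomial(1)[OF p] polytime_string_fun_id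
    by (intro exI[of _ "\<lambda>_. -1"] exI[of _ "\<lambda>x. x"] exI[of _ "\<lambda>x. 2 ^ p (length x)"]) simp
  then show ?thesis using g by blast
qed

lemma sharpP_reduces_to_weighted:
  assumes "f \<in> sharpP"
  shows "\<exists>g\<in>sharpP_weighted {-1, 1}. affinely_reduces f g"
proof -
  obtain p T where f: "f = counting_function p (\<lambda>x u. of_bool (T x u))" and p: "polynomial_fun p"
    and T: "polytime_predicate T"
    using assms unfolding sharpP_def by blast
  \<comment> \<open>The weights are integers computed exactly, so the approximation has no error and
    is a signed power of 2.\<close>
  define v where "v x u b = (if T x u then -1 else 1) * (2 :: int) ^ b" for x u b
  define w :: "bool list \<Rightarrow> bool list \<Rightarrow> real" where "w x u = (if T x u then -1 else 1)" for x u
  have w: "\<forall>x u. w x u \<in> {-1, 1}" by (simp add: w_def)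
  have "polytime 3 (\<lambda>xs. [T (xs ! 0) (xs ! 1)])"
    using polytime_comp2[OF T[unfolded polytime_predicate_def] polytime_nth[of 0 3] polytime_nth[of 1 3]] by simp
  moreover have "polytime 3 (\<lambda>xs. xs ! 2)" by (rule polytime_nth) simp
  ultimately have "polytime_approx v"
    unfolding polytime_approx_def
    by (rule polytime_cong[OF polytime_comp2[OF polytime_power]]) (simp add: v_def int_bits_power)
  then have "weighted_counting_problem p w"
    unfolding weighted_counting_problem_def using p
    by (intro conjI exI[of _ v]) (auto simp: v_def w_def)
  then have g: "counting_function p w \<in> sharpP_weighted {-1, 1}"
    unfolding sharpP_weighted_def using w by blast
  have "w x u = 1 - 2 * of_bool (T x u)" for x u by (simp add: w_def)
  then have "counting_function p w x = 2 ^ p (length x) - 2 * f x" for x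
    by (simp add: f counting_function_def sum_subtractf card_lists_bool flip: sum_distrib_left)
  then have "f x = of_rat (- 1 / 2) * counting_function p w x + of_rat (2 ^ p (length x) / 2)" for x
    by (simp add: of_rat_power of_rat_divide of_rat_minus field_simps)
  \<comment> \<open>The Newton form \<open>[1]\<close> of the constant 1 makes the coefficient
    \<open>- 2 ^ 0 / 2 ^ 1\<close>.\<close>
  then have "affinely_reduces f (counting_function p w)"
    unfolding affinely_reduces_def
    using polytime_rat_fun_power[of "-1" "[]" "[1]"] polytime_rat_fun_power_polynomial(2)[OF p] polytime_string_fun_id
    by (intro exI[of _ "\<lambda>_. - 1 / 2"] exI[of _ "\<lambda>x. x"] exI[of _ "\<lambda>x. 2 ^ p (length x) / 2"]) simp
  then show ?thesis using g by blast
qed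

lemma sharpP_weighted_mono: "S \<subseteq> S' \<Longrightarrow> sharpP_weighted S \<subseteq> sharpP_weighted S'"
  unfolding sharpP_weighted_def by blast

text \<open>Summing the signs over all \<open>y\<close> gives back \<open>w x u\<close>. As
  \<open>y\<close> precedes \<open>u\<close>, the machine splits at \<open>q (length x)\<close>, a
  Newton form computed in unary, and never has to evaluate \<open>p\<close>.\<close>

lemma sharpP_weighted_Ints_subset: "sharpP_weighted \<int> \<subseteq> sharpP_weighted {-1, 0, 1}"
proof
  fix f
  assume "f \<in> sharpP_weighted \<int>"
  then obtain p w v where f: "f = counting_function p w" and p: "polynomial_fun p"
    and v: "polytime_approx v" "\<And>x u b. \<bar>w x u - real_of_int (v x u b) / 2 ^ b\<bar> \<le> 1 / 2 ^ b"
    and w: "\<And>x u. w x u \<in> \<int>"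
    unfolding sharpP_weighted_def weighted_counting_problem_def by blast
  have V: "polytime 3 (\<lambda>xs. int_bits (v (xs ! 0) (xs ! 1) (length (xs ! 2))))"
    using v(1) unfolding polytime_approx_def .
  \<comment> \<open>The output length bounds the number of digits of \<open>v\<close>, hence the
    size of the weights.\<close>
  obtain t where t: "polynomial_fun t"
    "\<And>xs. length xs = 3 \<Longrightarrow> length (int_bits (v (xs ! 0) (xs ! 1) (length (xs ! 2)))) \<le> t (total_length xs)"
    using polytimeE[OF V] by metis
  \<comment> \<open>The argument of \<open>t\<close> is the total length of \<open>x\<close>,
    \<open>u\<close> and the precision 2 in unary.\<close>
  have "polynomial_fun (\<lambda>n. t (n + p n + 2))"
    by (intro polynomial_fun_compose[OF t(1)] polynomial_fun_add polynomial_fun_id polynomial_fun_const p)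
  then obtain cs where cs: "t (n + p n + 2) \<le> newton cs n" for n
    using polynomial_fun_le_newton by blast
  define q where "q = newton cs"
  define z where "z x u = v x (drop (q (length x)) u) 2" for x u
  define w' :: "bool list \<Rightarrow> bool list \<Rightarrow> int" where
    "w' x u = (if 4 * bits_value (take (q (length x)) u) + 2 < nat \<bar>z x u\<bar> then sgn (z x u) else 0)" for x u
  have "polytime 3 (\<lambda>xs. drop (q (length (xs ! 0))) (xs ! 1))"
    using polytime_comp2[OF polytime_drop polytime_nth[of 1 3] polytime_unary_first[of 3 cs True]] by (simp add: q_def)
  from polytime_comp3[OF V polytime_nth[of 0 3] this polytime_const_unary[of 3 2 True]]
  have "polytime 3 (\<lambda>xs. int_bits (z (xs ! 0) (xs ! 1)))" by (simp add: z_def)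
  moreover have "polytime 3 (\<lambda>xs. take (q (length (xs ! 0))) (xs ! 1))"
    using polytime_comp2[OF polytime_take polytime_nth[of 1 3] polytime_unary_first[of 3 cs True]] by (simp add: q_def)
  ultimately have "polytime 3 (\<lambda>xs. if 4 * bits_value (take (q (length (xs ! 0))) (xs ! 1)) + 2 < nat \<bar>z (xs ! 0) (xs ! 1)\<bar>
      then [z (xs ! 0) (xs ! 1) < 0] else [])"
    by (rule polytime_cong[OF polytime_comp2[OF polytime_compare]]) (simp add: int_bits_simps)
  moreover have "polytime 3 (\<lambda>xs. xs ! 2)" by (rule polytime_nth) simp
  \<comment> \<open>The comparison yields a sign bit or the empty string, the two kinds of input
    from which \<open>polytime_power\<close> produces the code of
    \<open>w' x u * 2 ^ b\<close>.\<close>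
  ultimately have "polytime_approx (\<lambda>x u b. w' x u * 2 ^ b)"
    unfolding polytime_approx_def
    by (rule polytime_cong[OF polytime_comp2[OF polytime_power]])
      (auto simp: w'_def int_bits_power int_bits_0 sgn_if)
  moreover have "polynomial_fun (\<lambda>n. q n + p n)"
    unfolding q_def by (intro polynomial_fun_add polynomial_fun_newton p)
  ultimately have "weighted_counting_problem (\<lambda>n. q n + p n) (\<lambda>x u. real_of_int (w' x u))"
    unfolding weighted_counting_problem_def
    by (intro conjI exI[of _ "\<lambda>x u b. w' x u * 2 ^ b"]) simp_all
  moreover have "real_of_int (w' x u) \<in> {-1, 0, 1}" for x u
    by (auto simp: w'_def sgn_if)
  ultimately have "counting_function (\<lambda>n. q n + p n) (\<lambda>x u. real_of_int (w' x u)) \<in> sharpP_weighted {-1, 0, 1}"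
    unfolding sharpP_weighted_def by blast
  moreover have "counting_function (\<lambda>n. q n + p n) (\<lambda>x u. real_of_int (w' x u)) x = f x" for x
  proof -
    define n where "n = length x"
    have "(\<Sum>y | length y = q n. real_of_int (w' x (y @ u))) = w x u" if u: "length u = p n" for u
    proof -
      define c where "c = v x u 2"
      obtain k where k: "w x u = real_of_int k" using w[of x u] by (auto elim: Ints_cases)
      have "\<bar>real_of_int (4 * k - c)\<bar> \<le> 1"
        using v(2)[of x u 2] unfolding k c_def[symmetric] by (simp add: abs_le_iff field_simps)
      then have kc: "\<bar>4 * k - c\<bar> \<le> 1" by linarith
      have "nat \<bar>c\<bar> < 2 ^ length (tl (int_bits c))"
        using bits_value_less[of "tl (int_bits c)"] by (simp add: int_bits_simps)
      also have "\<dots> \<le> 2 ^ q n"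
        using t(2)[of "[x, u, [True, True]]"] u cs[of n]
        by (intro power_increasing) (simp_all add: c_def n_def q_def numeral_2_eq_2)
      \<comment> \<open>Indeed \<open>4 * |k| \<le> |c| + 1 \<le> 2 ^ q n\<close>, so there are
        enough strings \<open>y\<close> to count up to \<open>|k|\<close>.\<close>
      finally have "nat \<bar>k\<bar> \<le> 2 ^ q n" using kc by linarith
      then have card: "card {y. length y = q n \<and> bits_value y < nat \<bar>k\<bar>} = nat \<bar>k\<bar>"
        by (rule card_bits_value_less)
      \<comment> \<open>The value \<open>4 * \<bar>k\<bar>\<close> is known up to an error of 1 only, but \<open>4 * m + 2\<close> has distance at least 2 from it.\<close>
      have lt: "4 * m + 2 < nat \<bar>c\<bar> \<longleftrightarrow> m < nat \<bar>k\<bar>" for m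
        using kc by linarith
      have "(\<Sum>y | length y = q n. w' x (y @ u)) =
        (\<Sum>y | length y = q n. if bits_value y < nat \<bar>k\<bar> then sgn c else 0)"
        by (intro sum.cong) (simp_all add: w'_def z_def lt flip: n_def c_def del: add_2_eq_Suc')
      also have "\<dots> = sgn c * nat \<bar>k\<bar>"
        using finite_lists_length_eq[of "UNIV :: bool set" "q n"]
        by (simp add: sum.If_cases Int_def card)
      \<comment> \<open>For \<open>k \<noteq> 0\<close> the signs of \<open>c\<close> and
        \<open>k\<close> agree; for \<open>k = 0\<close> the sign of \<open>c\<close> may be
        nonzero, but the factor \<open>|k|\<close> vanishes.\<close>
      also have "\<dots> = k" using kc by (auto simp: sgn_if abs_if)
      finally show ?thesis using k by (metis of_int_sum)
    qed
    then have "(\<Sum>u | length u = p n. \<Sum>y | length y = q n. real_of_int (w' x (y @ u))) = (\<Sum>u | length u = p n. w x u)"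
      by (intro sum.cong) simp_all
    then show ?thesis
      unfolding f counting_function_def sum_lists_add n_def by (subst sum.swap)
  qed
  ultimately show "f \<in> sharpP_weighted {-1, 0, 1}" by (metis ext)
qed

theorem theorem5:
  shows "sharpP_equivalent (sharpP_weighted {-1, 1})
       \<and> sharpP_equivalent (sharpP_weighted {-1, 0, 1})
       \<and> sharpP_weighted {-1, 0, 1} = sharpP_weighted \<int>"
proof -
  \<comment> \<open>Along this inclusion, reductions to \<open>sharpP\<close> restrict to the
    smaller class, and reductions from \<open>sharpP\<close> extend to the larger one.\<close>
  have sub: "sharpP_weighted {-1, 1} \<subseteq> sharpP_weighted {-1, 0, 1}"
    by (rule sharpP_weighted_mono) auto
  have "sharpP_weighted {-1, 0, 1} \<subseteq> sharpP_weighted \<int>"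
    by (rule sharpP_weighted_mono) auto
  then show ?thesis
    using sub weighted_reduces_to_sharpP sharpP_reduces_to_weighted sharpP_weighted_Ints_subset
    unfolding sharpP_equivalent_def by blast
qed

end
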